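(* Let $\Xi$ be a $2n$-dimensional real symplectic vector space with symplectic form $[\![\cdot,\cdot]\!]$, let $\Sigma$ be a locally compact (Hausdorff) space with a continuous action $\Theta$ of $\Xi$ by homeomorphisms, and let $d\sigma$ be a $\Theta$-invariant measure on $\Sigma$. Let $M$ be the canonical mapping on $L^2(\Xi\times\Sigma)$, formally given by $$[M(F)](X,\sigma)=\int_\Xi dY\,e^{-i[\![X,Y]\!]}\,F\big(Y,\Theta_Y(\sigma)\big).$$ Then for all $F,G\in L^2(\Xi\times\Sigma)$ one has the orthogonality relations $$\big\langle\overline{M(F)},M(G)\big\rangle_{\Xi\times\Sigma}=\big\langle\overline F,G\big\rangle_{\Xi\times\Sigma}.$$ Thus the operator $M:L^2(\Xi\times\Sigma)\to L^2(\Xi\times\Sigma)$ is unitary.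
   Context: $dX$ is the Lebesgue measure on $\Xi$ normalized so that the symplectic Fourier transform $(\mathcal F a)(X)=\int_\Xi dY\,e^{-i[\![X,Y]\!]}a(Y)$ is unitary on $L^2(\Xi)$ (then $\mathcal F^2=\mathrm{id}$). The measure $d\sigma$ is a positive Radon measure invariant under all homeomorphisms $\Theta_X$, $X\in\Xi$. $L^2(\Xi\times\Sigma)$ is taken with respect to the product measure $dX\,d\sigma$. The pairing is bilinear, $\langle u,v\rangle_{\Xi\times\Sigma}=\int_\Xi\int_\Sigma u(X,\sigma)\,v(X,\sigma)\,dX\,d\sigma$, so that $\langle\overline u,v\rangle$ is the usual scalar product. The rigorous definition of $M$ on $L^2(\Xi\times\Sigma)$ is $M=\mathfrak F\circ C$, where $(CF)(X,\sigma)=F(X,\Theta_X(\sigma))$ and $\mathfrak F=\mathcal F\otimes1$ is the partial symplectic Fourier transform in the variable $X\in\Xi$, extended from integrable functions to $L^2(\Xi\times\Sigma)$ in the usual way. (This corresponds to the $C^*$-algebra $\mathcal A=C_0(\Sigma)$ with the action $[\Theta_X(f)](\sigma)=f(\Theta_X(\sigma))$.) *)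

theory Defs
  imports "HOL-Analysis.Analysis"
begin

section \<open>Square-integrable functions and operators on them\<close>

text \<open>Elements of \<open>L\<^sup>2\<close> are represented by functions; equality in \<open>L\<^sup>2\<close> is equality
  almost everywhere, and statements about operators are made modulo this relation.\<close>

definition L2 :: "'a measure \<Rightarrow> ('a \<Rightarrow> complex) set" where
  "L2 M = {f \<in> borel_measurable M. integrable M (\<lambda>x. (cmod (f x))\<^sup>2)}"

definition L2_tendsto :: "'a measure \<Rightarrow> (nat \<Rightarrow> 'a \<Rightarrow> complex) \<Rightarrow> ('a \<Rightarrow> complex) \<Rightarrow> bool" where
  "L2_tendsto M f g \<longleftrightarrow> (\<forall>k. f k \<in> L2 M) \<and> g \<in> L2 M \<and>
     (\<lambda>k. \<integral>x. (cmod (f k x - g x))\<^sup>2 \<partial>M) \<longlonglongrightarrow> 0"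

text \<open>The pairing is bilinear; the scalar product of \<open>f\<close> and \<open>g\<close> is
  \<open>pairing M (\<lambda>x. cnj (f x)) g\<close>.\<close>

definition pairing :: "'a measure \<Rightarrow> ('a \<Rightarrow> complex) \<Rightarrow> ('a \<Rightarrow> complex) \<Rightarrow> complex" where
  "pairing M u v = (\<integral>x. u x * v x \<partial>M)"

definition unitary_on_L2 :: "'a measure \<Rightarrow> (('a \<Rightarrow> complex) \<Rightarrow> 'a \<Rightarrow> complex) \<Rightarrow> bool" where
  "unitary_on_L2 M U \<longleftrightarrow>
     (\<forall>f\<in>L2 M. U f \<in> L2 M) \<and>
     (\<forall>f\<in>L2 M. \<forall>g\<in>L2 M. (AE x in M. f x = g x) \<longrightarrow> (AE x in M. U f x = U g x)) \<and>
     (\<forall>f\<in>L2 M. \<forall>g\<in>L2 M. \<forall>a b. AE x in M. U (\<lambda>y. a * f y + b * g y) x = a * U f x + b * U g x) \<and>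
     (\<forall>f\<in>L2 M. \<forall>g\<in>L2 M.
        pairing M (\<lambda>x. cnj (U f x)) (U g) = pairing M (\<lambda>x. cnj (f x)) g) \<and>
     (\<forall>h\<in>L2 M. \<exists>f\<in>L2 M. AE x in M. U f x = h x)"

text \<open>\<open>U\<close> is the continuous extension to \<open>L\<^sup>2\<close> of the operator \<open>T\<close>, which is meaningful
  on integrable functions. As \<open>L\<^sup>1 \<inter> L\<^sup>2\<close> is dense in \<open>L\<^sup>2\<close>, such a \<open>U\<close> is unique modulo
  almost everywhere equality.\<close>

definition L2_extension ::
  "'a measure \<Rightarrow> (('a \<Rightarrow> complex) \<Rightarrow> 'a \<Rightarrow> complex) \<Rightarrow> (('a \<Rightarrow> complex) \<Rightarrow> 'a \<Rightarrow> complex) \<Rightarrow> bool" where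
  "L2_extension M T U \<longleftrightarrow>
     (\<forall>f\<in>L2 M. U f \<in> L2 M) \<and>
     (\<forall>f\<in>L2 M. integrable M f \<longrightarrow> (AE x in M. U f x = T f x)) \<and>
     (\<forall>f g. L2_tendsto M f g \<longrightarrow> L2_tendsto M (\<lambda>k. U (f k)) (U g))"


section \<open>Symplectic form, Fourier transform and normalized Lebesgue measure\<close>

definition symplectic_form :: "('x::real_vector \<Rightarrow> 'x \<Rightarrow> real) \<Rightarrow> bool" where
  "symplectic_form \<omega> \<longleftrightarrow>
     bilinear \<omega> \<and> (\<forall>x. \<omega> x x = 0) \<and> (\<forall>x. (\<forall>y. \<omega> x y = 0) \<longrightarrow> x = 0)"

definition symplectic_fourier ::
  "('x \<Rightarrow> 'x \<Rightarrow> real) \<Rightarrow> 'x measure \<Rightarrow> ('x \<Rightarrow> complex) \<Rightarrow> 'x \<Rightarrow> complex" where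
  "symplectic_fourier \<omega> dX a X = (\<integral>Y. exp (- (\<i> * of_real (\<omega> X Y))) * a Y \<partial>dX)"

text \<open>The inner product of the type \<open>'x\<close> enters only through \<open>lborel\<close>, that is, through a
  choice of scale which the normalization undoes: exactly one multiple of Lebesgue measure makes
  the symplectic Fourier transform unitary.\<close>

definition normalized_lebesgue ::
  "('x::euclidean_space \<Rightarrow> 'x \<Rightarrow> real) \<Rightarrow> 'x measure \<Rightarrow> bool" where
  "normalized_lebesgue \<omega> dX \<longleftrightarrow>
     (\<exists>c::real. c > 0 \<and> dX = scale_measure (ennreal c) lborel) \<and>
     (\<exists>U. L2_extension dX (symplectic_fourier \<omega> dX) U \<and> unitary_on_L2 dX U)"


section \<open>Actions and invariant Radon measures\<close>

definition continuous_action ::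
  "('x::real_normed_vector \<Rightarrow> 's::topological_space \<Rightarrow> 's) \<Rightarrow> bool" where
  "continuous_action \<Theta> \<longleftrightarrow>
     (\<forall>s. \<Theta> 0 s = s) \<and> (\<forall>X Y s. \<Theta> (X + Y) s = \<Theta> X (\<Theta> Y s)) \<and>
     continuous_on UNIV (\<lambda>(X, s). \<Theta> X s)"

text \<open>Inner regularity on all Borel sets is required. Representing the same functional on \<open>C\<^sub>c\<close>
  by a measure that is outer regular on Borel sets and inner regular on open sets differs only
  outside sigma-finite sets and leads to the same \<open>L\<^sup>2\<close> spaces.\<close>

definition radon_measure :: "'s::t2_space measure \<Rightarrow> bool" where
  "radon_measure m \<longleftrightarrow>
     sets m = sets borel \<and>
     (\<forall>K. compact K \<longrightarrow> emeasure m K < \<infinity>) \<and>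
     (\<forall>A\<in>sets borel. emeasure m A = (SUP K\<in>{K. compact K \<and> K \<subseteq> A}. emeasure m K))"

definition invariant_measure :: "('x \<Rightarrow> 's \<Rightarrow> 's) \<Rightarrow> 's::topological_space measure \<Rightarrow> bool" where
  "invariant_measure \<Theta> m \<longleftrightarrow> (\<forall>X. \<forall>A\<in>sets m. emeasure m (\<Theta> X -` A) = emeasure m A)"

text \<open>The product measure \<open>dX d\<sigma>\<close> assigns to \<open>A\<close> the integral over \<open>\<Sigma>\<close> of the \<open>dX\<close>-measure
  of its sections. A Radon measure on \<open>\<Sigma>\<close> need not be sigma-finite, and
  \<open>dX \<Otimes>\<^sub>M d\<sigma>\<close> is defined by integrating over \<open>\<Sigma>\<close> first, which need not be countably
  additive without sigma-finiteness (the library then returns the zero measure). In the other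
  order only \<open>dX\<close> has to be sigma-finite. By the lemma below, both coincide if \<open>d\<sigma>\<close> is
  sigma-finite as well.\<close>

definition product_measure :: "'x measure \<Rightarrow> 's measure \<Rightarrow> ('x \<times> 's) measure" where
  "product_measure dX d\<sigma> = distr (d\<sigma> \<Otimes>\<^sub>M dX) (dX \<Otimes>\<^sub>M d\<sigma>) (\<lambda>(s, X). (X, s))"

lemma product_measure_eq_pair_measure:
  assumes "sigma_finite_measure dX" "sigma_finite_measure d\<sigma>"
  shows "product_measure dX d\<sigma> = dX \<Otimes>\<^sub>M d\<sigma>"
proof -
  interpret pair_sigma_finite dX d\<sigma>
    using assms by (simp add: pair_sigma_finite_def)
  show ?thesis
    unfolding product_measure_def by (rule distr_pair_swap[symmetric])
qed

lemma emeasure_product_measure: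
  assumes "sigma_finite_measure dX" and A: "A \<in> sets (dX \<Otimes>\<^sub>M d\<sigma>)"
  shows "emeasure (product_measure dX d\<sigma>) A = (\<integral>\<^sup>+s. emeasure dX {X. (X, s) \<in> A} \<partial>d\<sigma>)"
proof -
  interpret sigma_finite_measure dX by fact
  have m: "(\<lambda>(s, X). (X, s)) \<in> d\<sigma> \<Otimes>\<^sub>M dX \<rightarrow>\<^sub>M dX \<Otimes>\<^sub>M d\<sigma>"
    by (rule measurable_pair_swap')
  have "emeasure (product_measure dX d\<sigma>) A =
      emeasure (d\<sigma> \<Otimes>\<^sub>M dX) ((\<lambda>(s, X). (X, s)) -` A \<inter> space (d\<sigma> \<Otimes>\<^sub>M dX))"
    unfolding product_measure_def by (rule emeasure_distr[OF m A])
  also have "\<dots> = (\<integral>\<^sup>+s. emeasure dX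
      (Pair s -` ((\<lambda>(s, X). (X, s)) -` A \<inter> space (d\<sigma> \<Otimes>\<^sub>M dX))) \<partial>d\<sigma>)"
    by (rule emeasure_pair_measure_alt[OF measurable_sets[OF m A]])
  also have "\<dots> = (\<integral>\<^sup>+s. emeasure dX {X. (X, s) \<in> A} \<partial>d\<sigma>)"
    using sets.sets_into_space[OF A]
    by (intro nn_integral_cong arg_cong[where f = "emeasure dX"])
       (auto simp: space_pair_measure)
  finally show ?thesis .
qed


section \<open>The canonical mapping\<close>

text \<open>The partial symplectic Fourier transform \<open>\<F> \<otimes> 1\<close> on integrable functions.\<close>

definition partial_fourier ::
  "('x \<Rightarrow> 'x \<Rightarrow> real) \<Rightarrow> 'x measure \<Rightarrow> ('x \<times> 's \<Rightarrow> complex) \<Rightarrow> 'x \<times> 's \<Rightarrow> complex" where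
  "partial_fourier \<omega> dX F = (\<lambda>(X, s). symplectic_fourier \<omega> dX (\<lambda>Y. F (Y, s)) X)"

definition partial_fourier_L2 ::
  "('x \<Rightarrow> 'x \<Rightarrow> real) \<Rightarrow> 'x measure \<Rightarrow> 's measure \<Rightarrow> ('x \<times> 's \<Rightarrow> complex) \<Rightarrow> 'x \<times> 's \<Rightarrow> complex" where
  "partial_fourier_L2 \<omega> dX d\<sigma> =
     (SOME U. L2_extension (product_measure dX d\<sigma>) (partial_fourier \<omega> dX) U)"

definition twist :: "('x \<Rightarrow> 's \<Rightarrow> 's) \<Rightarrow> ('x \<times> 's \<Rightarrow> complex) \<Rightarrow> 'x \<times> 's \<Rightarrow> complex" where
  "twist \<Theta> F = (\<lambda>(X, s). F (X, \<Theta> X s))"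

definition canonical_map ::
  "('x \<Rightarrow> 'x \<Rightarrow> real) \<Rightarrow> 'x measure \<Rightarrow> 's measure \<Rightarrow> ('x \<Rightarrow> 's \<Rightarrow> 's) \<Rightarrow>
     ('x \<times> 's \<Rightarrow> complex) \<Rightarrow> 'x \<times> 's \<Rightarrow> complex" where
  "canonical_map \<omega> dX d\<sigma> \<Theta> = partial_fourier_L2 \<omega> dX d\<sigma> \<circ> twist \<Theta>"

end

theory Submission
  imports Defs
begin

text \<open>
  The canonical mapping is the composition of the twist \<open>F(X, \<sigma>) \<mapsto> F(X, \<Theta>\<^sub>X \<sigma>)\<close> with the partial
  Fourier transform \<open>\<F> \<otimes> 1\<close>, and both factors are unitary on \<open>L\<^sup>2(\<Xi> \<times> \<Sigma>)\<close>. The orthogonality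
  relations are part of unitarity.

  The twist is unitary because the shear \<open>(X, \<sigma>) \<mapsto> (X, \<Theta>\<^sub>X \<sigma>)\<close> is invertible and preserves
  \<open>dX d\<sigma>\<close> (\<open>twist_unitary\<close>): for fixed \<open>X\<close> this is the invariance of \<open>d\<sigma>\<close>. Since \<open>d\<sigma>\<close> may fail to
  be sigma-finite, the order of integration cannot be exchanged at once. In \<open>nn_integral_shear_le\<close> the
  integral over \<open>\<Sigma>\<close> is first reduced to compact sets by inner regularity, and then to the orbit of a
  compact set, which is invariant and sigma-compact.

  The partial Fourier transform is handled fibre by fibre (\<open>partial_fourier_L2_unitary\<close>). On
  functions that are both integrable and square-integrable, the normalization of \<open>dX\<close> gives
  Plancherel's identity in almost every fibre \<open>F(\<cdot>, \<sigma>)\<close>, and integration over \<open>\<Sigma>\<close> turns it into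
  an isometry for \<open>dX d\<sigma>\<close>. Such functions are dense and \<open>L\<^sup>2\<close> is complete (\<open>L2_complete\<close>), so the
  transform extends to \<open>L\<^sup>2\<close> (\<open>ex_L2_extension\<close>) and every continuous extension is isometric.
  Surjectivity comes from antisymmetry: since \<open>\<lbrakk>X, Y\<rbrakk> = - \<lbrakk>Y, X\<rbrakk>\<close>, the transform is symmetric for the
  scalar product, and a symmetric isometry is its own inverse (\<open>extension_unitary\<close>).
\<close>

section \<open>Calculus with square-integrable functions\<close>

lemma L2_D [measurable_dest]: "f \<in> L2 M \<Longrightarrow> f \<in> borel_measurable M"
  by (simp add: L2_def)

lemma L2_integrable: "f \<in> L2 M \<Longrightarrow> integrable M (\<lambda>x. (cmod (f x))\<^sup>2)"
  by (simp add: L2_def)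

lemma L2_iff_nn_integral:
  "f \<in> L2 M \<longleftrightarrow> f \<in> borel_measurable M \<and> (\<integral>\<^sup>+x. ennreal ((cmod (f x))\<^sup>2) \<partial>M) < \<infinity>"
  unfolding L2_def by (auto simp: integrable_iff_bounded)

lemma borel_measurable_cnj [measurable (raw)]:
  fixes f :: "'a \<Rightarrow> complex"
  assumes "f \<in> borel_measurable M"
  shows "(\<lambda>x. cnj (f x)) \<in> borel_measurable M"
  by (rule borel_measurable_continuous_on[OF continuous_on_cnj[OF continuous_on_id] assms])

text \<open>The squared norm is used throughout instead of the norm: it is an integral, hence can
  be computed fibrewise on products, and convergence to \<open>0\<close> only needs the weak triangle
  inequality \<open>sqnorm_add_le\<close> with its factor \<open>2\<close>.\<close>

definition sqnorm :: "'a measure \<Rightarrow> ('a \<Rightarrow> complex) \<Rightarrow> real" where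
  "sqnorm M f = (\<integral>x. (cmod (f x))\<^sup>2 \<partial>M)"

lemma sqnorm_nonneg: "0 \<le> sqnorm M f"
  by (simp add: sqnorm_def)

lemma sqnorm_diff_commute: "sqnorm M (\<lambda>x. f x - g x) = sqnorm M (\<lambda>x. g x - f x)"
  by (simp add: sqnorm_def norm_minus_commute)

lemma sqnorm_cong_AE:
  assumes "f \<in> borel_measurable M" "g \<in> borel_measurable M" "AE x in M. f x = g x"
  shows "sqnorm M f = sqnorm M g"
  unfolding sqnorm_def using assms by (intro integral_cong_AE) auto

lemma L2_tendsto_iff:
  "L2_tendsto M f g \<longleftrightarrow>
     (\<forall>k. f k \<in> L2 M) \<and> g \<in> L2 M \<and> (\<lambda>k. sqnorm M (\<lambda>x. f k x - g x)) \<longlonglongrightarrow> 0"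
  by (simp add: L2_tendsto_def sqnorm_def)

lemma cmod_add_squared_le:
  fixes u v :: complex
  shows "(cmod (u + v))\<^sup>2 \<le> 2 * (cmod u)\<^sup>2 + 2 * (cmod v)\<^sup>2"
proof -
  have "(cmod (u + v))\<^sup>2 \<le> (cmod u + cmod v)\<^sup>2"
    by (intro power_mono norm_triangle_ineq) auto
  moreover have "0 \<le> (cmod u - cmod v)\<^sup>2"
    by simp
  ultimately show ?thesis
    by (simp add: power2_eq_square algebra_simps)
qed

lemma L2_lincomb:
  assumes f: "f \<in> L2 M" and g: "g \<in> L2 M"
  shows "(\<lambda>x. a * f x + b * g x) \<in> L2 M"
proof -
  have [measurable]: "f \<in> borel_measurable M" "g \<in> borel_measurable M"
    using f g by (auto simp: L2_def)
  have "integrable M (\<lambda>x. (cmod (a * f x + b * g x))\<^sup>2)"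
  proof (rule Bochner_Integration.integrable_bound)
    show "integrable M (\<lambda>x. 2 * ((cmod a)\<^sup>2 * (cmod (f x))\<^sup>2) + 2 * ((cmod b)\<^sup>2 * (cmod (g x))\<^sup>2))"
      using L2_integrable[OF f] L2_integrable[OF g] by simp
    show "AE x in M. norm ((cmod (a * f x + b * g x))\<^sup>2) \<le>
        norm (2 * ((cmod a)\<^sup>2 * (cmod (f x))\<^sup>2) + 2 * ((cmod b)\<^sup>2 * (cmod (g x))\<^sup>2))"
    proof (intro AE_I2)
      fix x
      show "norm ((cmod (a * f x + b * g x))\<^sup>2) \<le>
        norm (2 * ((cmod a)\<^sup>2 * (cmod (f x))\<^sup>2) + 2 * ((cmod b)\<^sup>2 * (cmod (g x))\<^sup>2))"
        using cmod_add_squared_le[of "a * f x" "b * g x"] by (simp add: norm_mult power_mult_distrib)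
    qed
  qed measurable
  then show ?thesis
    by (simp add: L2_def)
qed

lemma L2_diff: "f \<in> L2 M \<Longrightarrow> g \<in> L2 M \<Longrightarrow> (\<lambda>x. f x - g x) \<in> L2 M"
  using L2_lincomb[of f M g 1 "-1"] by simp

lemma sqnorm_add_le:
  assumes "f \<in> L2 M" "g \<in> L2 M"
  shows "sqnorm M (\<lambda>x. f x + g x) \<le> 2 * sqnorm M f + 2 * sqnorm M g"
proof -
  have "sqnorm M (\<lambda>x. f x + g x) \<le> (\<integral>x. 2 * (cmod (f x))\<^sup>2 + 2 * (cmod (g x))\<^sup>2 \<partial>M)"
    unfolding sqnorm_def
    using L2_integrable[OF L2_lincomb[OF assms, of 1 1]] L2_integrable[OF assms(1)] L2_integrable[OF assms(2)]
    by (intro integral_mono) (auto intro: cmod_add_squared_le)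
  also have "\<dots> = 2 * sqnorm M f + 2 * sqnorm M g"
    using L2_integrable[OF assms(1)] L2_integrable[OF assms(2)] by (simp add: sqnorm_def)
  finally show ?thesis .
qed

lemma sqnorm_scale: "sqnorm M (\<lambda>x. a * f x) = (cmod a)\<^sup>2 * sqnorm M f"
  by (simp add: sqnorm_def norm_mult power_mult_distrib)

lemma sqnorm_eq_0_iff:
  assumes "f \<in> L2 M"
  shows "sqnorm M f = 0 \<longleftrightarrow> (AE x in M. f x = 0)"
  unfolding sqnorm_def using integral_nonneg_eq_0_iff_AE[OF L2_integrable[OF assms]] by simp

lemma nn_integral_eq_sqnorm:
  assumes "f \<in> L2 M"
  shows "(\<integral>\<^sup>+x. ennreal ((cmod (f x))\<^sup>2) \<partial>M) = ennreal (sqnorm M f)"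
  unfolding sqnorm_def by (rule nn_integral_eq_integral[OF L2_integrable[OF assms]]) simp

lemma integrable_cnj_mult:
  assumes f: "f \<in> L2 M" and g: "g \<in> L2 M"
  shows "integrable M (\<lambda>x. cnj (f x) * g x)"
proof (rule Bochner_Integration.integrable_bound)
  have [measurable]: "f \<in> borel_measurable M" "g \<in> borel_measurable M"
    using f g by (auto simp: L2_def)
  show "integrable M (\<lambda>x. (cmod (f x))\<^sup>2 + (cmod (g x))\<^sup>2)"
    using L2_integrable[OF f] L2_integrable[OF g] by simp
  show "(\<lambda>x. cnj (f x) * g x) \<in> borel_measurable M"
    by measurable
  show "AE x in M. norm (cnj (f x) * g x) \<le> norm ((cmod (f x))\<^sup>2 + (cmod (g x))\<^sup>2)"
  proof (intro AE_I2)
    fix x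
    have "0 \<le> (cmod (f x) - cmod (g x))\<^sup>2" by simp
    then have "2 * (cmod (f x) * cmod (g x)) \<le> (cmod (f x))\<^sup>2 + (cmod (g x))\<^sup>2"
      by (simp add: power2_eq_square algebra_simps)
    moreover have "0 \<le> cmod (f x) * cmod (g x)" by simp
    ultimately have "cmod (f x) * cmod (g x) \<le> (cmod (f x))\<^sup>2 + (cmod (g x))\<^sup>2"
      by linarith
    then show "norm (cnj (f x) * g x) \<le> norm ((cmod (f x))\<^sup>2 + (cmod (g x))\<^sup>2)"
      by (simp add: norm_mult)
  qed
qed

abbreviation (input) inner_L2 :: "'a measure \<Rightarrow> ('a \<Rightarrow> complex) \<Rightarrow> ('a \<Rightarrow> complex) \<Rightarrow> complex" where
  "inner_L2 M f g \<equiv> pairing M (\<lambda>x. cnj (f x)) g"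

lemma inner_L2_self: "inner_L2 M f f = of_real (sqnorm M f)"
proof -
  have "cnj z * z = of_real ((cmod z)\<^sup>2)" for z
    by (metis complex_norm_square mult.commute)
  then show ?thesis
    by (simp add: pairing_def sqnorm_def del: of_real_power)
qed

lemma inner_L2_commute: "inner_L2 M g f = cnj (inner_L2 M f g)"
  unfolding pairing_def by (subst Bochner_Integration.integral_cnj[symmetric]) (simp add: mult.commute)

lemma inner_L2_lincomb_right:
  assumes "f \<in> L2 M" "g \<in> L2 M" "h \<in> L2 M"
  shows "inner_L2 M h (\<lambda>x. a * f x + b * g x) = a * inner_L2 M h f + b * inner_L2 M h g"
proof -
  have "inner_L2 M h (\<lambda>x. a * f x + b * g x) =
      (\<integral>x. a * (cnj (h x) * f x) + b * (cnj (h x) * g x) \<partial>M)"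
    unfolding pairing_def by (simp add: algebra_simps)
  also have "\<dots> = a * inner_L2 M h f + b * inner_L2 M h g"
    unfolding pairing_def
    using integrable_cnj_mult[OF assms(3,1)] integrable_cnj_mult[OF assms(3,2)] by simp
  finally show ?thesis .
qed

lemma inner_L2_diff_right:
  assumes "f \<in> L2 M" "g \<in> L2 M" "h \<in> L2 M"
  shows "inner_L2 M h (\<lambda>x. f x - g x) = inner_L2 M h f - inner_L2 M h g"
  using inner_L2_lincomb_right[OF assms, of 1 "-1"] by simp

lemma inner_L2_diff_left:
  assumes "f \<in> L2 M" "g \<in> L2 M" "h \<in> L2 M"
  shows "inner_L2 M (\<lambda>x. f x - g x) h = inner_L2 M f h - inner_L2 M g h"
  using inner_L2_diff_right[OF assms] inner_L2_commute[of M h]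
  by (metis complex_cnj_diff inner_L2_commute)

lemma inner_L2_cong_AE:
  assumes "f \<in> borel_measurable M" "f' \<in> borel_measurable M"
    and "g \<in> borel_measurable M" "g' \<in> borel_measurable M"
    and "AE x in M. f x = f' x" "AE x in M. g x = g' x"
  shows "inner_L2 M f g = inner_L2 M f' g'"
  unfolding pairing_def
proof (rule integral_cong_AE)
  show "AE x in M. cnj (f x) * g x = cnj (f' x) * g' x"
    using assms(5,6) by eventually_elim simp
  note [measurable] = assms(1-4)
  show "(\<lambda>x. cnj (f x) * g x) \<in> borel_measurable M" "(\<lambda>x. cnj (f' x) * g' x) \<in> borel_measurable M"
    by measurable
qed

lemma Cauchy_Schwarz_L2:
  assumes f: "f \<in> L2 M" and g: "g \<in> L2 M"
  shows "cmod (inner_L2 M f g) \<le> sqrt (sqnorm M f * sqnorm M g)"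
proof -
  have [measurable]: "f \<in> borel_measurable M" "g \<in> borel_measurable M"
    using f g by (auto simp: L2_def)
  define I where "I = (\<integral>x. cmod (f x) * cmod (g x) \<partial>M)"
  have int: "integrable M (\<lambda>x. cmod (f x) * cmod (g x))"
    using integrable_norm[OF integrable_cnj_mult[OF f g]] by (simp add: norm_mult)
  have I0: "0 \<le> I"
    unfolding I_def by simp
  have "ennreal (I\<^sup>2) = (\<integral>\<^sup>+x. ennreal (cmod (f x)) * ennreal (cmod (g x)) \<partial>M)\<^sup>2"
    using nn_integral_eq_integral[OF int] I0
    by (simp add: I_def ennreal_power ennreal_mult')
  also have "\<dots> \<le> (\<integral>\<^sup>+x. (ennreal (cmod (f x)))\<^sup>2 \<partial>M) * (\<integral>\<^sup>+x. (ennreal (cmod (g x)))\<^sup>2 \<partial>M)"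
    by (rule Cauchy_Schwarz_nn_integral) measurable
  also have "\<dots> = ennreal (sqnorm M f * sqnorm M g)"
    using nn_integral_eq_sqnorm[OF f] nn_integral_eq_sqnorm[OF g]
    by (simp add: ennreal_power ennreal_mult sqnorm_nonneg)
  finally have "I\<^sup>2 \<le> sqnorm M f * sqnorm M g"
    by (subst (asm) ennreal_le_iff) (auto simp: sqnorm_nonneg)
  then have "I \<le> sqrt (sqnorm M f * sqnorm M g)"
    by (rule real_le_rsqrt)
  moreover have "cmod (inner_L2 M f g) \<le> I"
    unfolding pairing_def I_def
    using integral_norm_bound[of M "\<lambda>x. cnj (f x) * g x"] by (simp add: norm_mult)
  ultimately show ?thesis
    by linarith
qed

section \<open>Convergence in square mean\<close>

lemma L2_tendsto_lincomb:
  assumes f: "L2_tendsto M f f'" and g: "L2_tendsto M g g'"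
  shows "L2_tendsto M (\<lambda>k x. a * f k x + b * g k x) (\<lambda>x. a * f' x + b * g' x)"
proof -
  have L: "f k \<in> L2 M" "g k \<in> L2 M" "f' \<in> L2 M" "g' \<in> L2 M" for k
    using f g by (auto simp: L2_tendsto_def)
  have lim: "(\<lambda>k. sqnorm M (\<lambda>x. f k x - f' x)) \<longlonglongrightarrow> 0" "(\<lambda>k. sqnorm M (\<lambda>x. g k x - g' x)) \<longlonglongrightarrow> 0"
    using f g by (auto simp: L2_tendsto_iff)
  have *: "(\<lambda>x. a * (h x - h' x)) \<in> L2 M" if "h \<in> L2 M" "h' \<in> L2 M" for a h h'
    using L2_lincomb[OF L2_diff[OF that] that(1), of a 0] by simp
  have le: "sqnorm M (\<lambda>x. (a * f k x + b * g k x) - (a * f' x + b * g' x)) \<le>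
      2 * ((cmod a)\<^sup>2 * sqnorm M (\<lambda>x. f k x - f' x)) + 2 * ((cmod b)\<^sup>2 * sqnorm M (\<lambda>x. g k x - g' x))" for k
  proof -
    have "(\<lambda>x. (a * f k x + b * g k x) - (a * f' x + b * g' x)) =
        (\<lambda>x. a * (f k x - f' x) + b * (g k x - g' x))"
      by (simp add: algebra_simps)
    moreover have "sqnorm M (\<lambda>x. a * (f k x - f' x) + b * (g k x - g' x)) \<le>
        2 * sqnorm M (\<lambda>x. a * (f k x - f' x)) + 2 * sqnorm M (\<lambda>x. b * (g k x - g' x))"
      by (rule sqnorm_add_le[OF *[OF L(1,3)] *[OF L(2,4)]])
    ultimately show ?thesis
      by (simp only: sqnorm_scale)
  qed
  have "(\<lambda>k. sqnorm M (\<lambda>x. (a * f k x + b * g k x) - (a * f' x + b * g' x))) \<longlonglongrightarrow> 0"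
  proof (rule tendsto_sandwich[OF _ always_eventually[OF allI[OF le]] tendsto_const])
    show "\<forall>\<^sub>F k in sequentially. 0 \<le> sqnorm M (\<lambda>x. (a * f k x + b * g k x) - (a * f' x + b * g' x))"
      by (simp add: sqnorm_nonneg)
    have "(\<lambda>k. 2 * ((cmod a)\<^sup>2 * sqnorm M (\<lambda>x. f k x - f' x)) +
        2 * ((cmod b)\<^sup>2 * sqnorm M (\<lambda>x. g k x - g' x))) \<longlonglongrightarrow>
        2 * ((cmod a)\<^sup>2 * 0) + 2 * ((cmod b)\<^sup>2 * 0)"
      by (intro tendsto_add tendsto_mult tendsto_const lim)
    then show "(\<lambda>k. 2 * ((cmod a)\<^sup>2 * sqnorm M (\<lambda>x. f k x - f' x)) +
        2 * ((cmod b)\<^sup>2 * sqnorm M (\<lambda>x. g k x - g' x))) \<longlonglongrightarrow> 0"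
      by simp
  qed
  then show ?thesis
    using L by (auto simp: L2_tendsto_iff intro!: L2_lincomb)
qed

lemma L2_tendsto_diff:
  assumes "L2_tendsto M f f'" "L2_tendsto M g g'"
  shows "L2_tendsto M (\<lambda>k x. f k x - g k x) (\<lambda>x. f' x - g' x)"
  using L2_tendsto_lincomb[OF assms, of 1 "-1"] by simp

lemma L2_tendsto_const: "f \<in> L2 M \<Longrightarrow> L2_tendsto M (\<lambda>_. f) f"
  by (simp add: L2_tendsto_iff sqnorm_def)

lemma L2_tendsto_cong_AE:
  assumes "L2_tendsto M f g" and "\<And>k. f' k \<in> L2 M" and "\<And>k. AE x in M. f k x = f' k x"
  shows "L2_tendsto M f' g"
proof -
  have "sqnorm M (\<lambda>x. f k x - g x) = sqnorm M (\<lambda>x. f' k x - g x)" for k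
  proof (rule sqnorm_cong_AE)
    show "AE x in M. f k x - g x = f' k x - g x"
      using assms(3)[of k] by eventually_elim simp
    have "f k \<in> L2 M" "g \<in> L2 M"
      using assms(1) by (auto simp: L2_tendsto_def)
    with assms(2)[of k] show "(\<lambda>x. f k x - g x) \<in> borel_measurable M" "(\<lambda>x. f' k x - g x) \<in> borel_measurable M"
      by (auto intro!: borel_measurable_diff L2_D)
  qed
  with assms show ?thesis
    by (simp add: L2_tendsto_iff)
qed

text \<open>Joint continuity of the scalar product. Expanding around the limit leaves three terms, each
  of which contains a difference that tends to \<open>0\<close> and is bounded by Cauchy--Schwarz. All identities
  below that pass from integrable functions to \<open>L\<^sup>2\<close> rest on this lemma.\<close>

lemma tendsto_inner_L2:
  assumes f: "L2_tendsto M f f'" and g: "L2_tendsto M g g'"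
  shows "(\<lambda>k. inner_L2 M (f k) (g k)) \<longlonglongrightarrow> inner_L2 M f' g'"
proof -
  have L: "f k \<in> L2 M" "g k \<in> L2 M" "f' \<in> L2 M" "g' \<in> L2 M" for k
    using f g by (auto simp: L2_tendsto_def)
  have lim: "(\<lambda>k. sqnorm M (\<lambda>x. f k x - f' x)) \<longlonglongrightarrow> 0" "(\<lambda>k. sqnorm M (\<lambda>x. g k x - g' x)) \<longlonglongrightarrow> 0"
    using f g by (auto simp: L2_tendsto_iff)
  have le: "cmod (inner_L2 M (f k) (g k) - inner_L2 M f' g') \<le>
      sqrt (sqnorm M (\<lambda>x. f k x - f' x) * sqnorm M (\<lambda>x. g k x - g' x)) +
      sqrt (sqnorm M (\<lambda>x. f k x - f' x) * sqnorm M g') +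
      sqrt (sqnorm M f' * sqnorm M (\<lambda>x. g k x - g' x))" for k
  proof -
    have "cmod (inner_L2 M (f k) (g k) - inner_L2 M f' g') =
        cmod (inner_L2 M (\<lambda>x. f k x - f' x) (\<lambda>x. g k x - g' x) +
        inner_L2 M (\<lambda>x. f k x - f' x) g' + inner_L2 M f' (\<lambda>x. g k x - g' x))"
      by (simp add: inner_L2_diff_left inner_L2_diff_right L L2_diff del: complex_cnj_diff)
    also have "\<dots> \<le> cmod (inner_L2 M (\<lambda>x. f k x - f' x) (\<lambda>x. g k x - g' x)) +
        cmod (inner_L2 M (\<lambda>x. f k x - f' x) g') + cmod (inner_L2 M f' (\<lambda>x. g k x - g' x))"
      by (intro order_trans[OF norm_triangle_ineq] add_right_mono norm_triangle_ineq)
    also have "\<dots> \<le> sqrt (sqnorm M (\<lambda>x. f k x - f' x) * sqnorm M (\<lambda>x. g k x - g' x)) +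
        sqrt (sqnorm M (\<lambda>x. f k x - f' x) * sqnorm M g') +
        sqrt (sqnorm M f' * sqnorm M (\<lambda>x. g k x - g' x))"
      by (intro add_mono Cauchy_Schwarz_L2 L2_diff L)
    finally show ?thesis .
  qed
  have "(\<lambda>k. sqrt (sqnorm M (\<lambda>x. f k x - f' x) * sqnorm M (\<lambda>x. g k x - g' x)) +
      sqrt (sqnorm M (\<lambda>x. f k x - f' x) * sqnorm M g') +
      sqrt (sqnorm M f' * sqnorm M (\<lambda>x. g k x - g' x))) \<longlonglongrightarrow>
      sqrt (0 * 0) + sqrt (0 * sqnorm M g') + sqrt (sqnorm M f' * 0)"
    by (intro tendsto_add tendsto_mult tendsto_real_sqrt tendsto_const lim)
  then have "(\<lambda>k. sqrt (sqnorm M (\<lambda>x. f k x - f' x) * sqnorm M (\<lambda>x. g k x - g' x)) +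
      sqrt (sqnorm M (\<lambda>x. f k x - f' x) * sqnorm M g') +
      sqrt (sqnorm M f' * sqnorm M (\<lambda>x. g k x - g' x))) \<longlonglongrightarrow> 0"
    by simp
  then have "(\<lambda>k. inner_L2 M (f k) (g k) - inner_L2 M f' g') \<longlonglongrightarrow> 0"
    by (rule Lim_null_comparison[OF always_eventually[OF allI[OF le]]])
  then show ?thesis
    by (simp add: LIM_zero_iff)
qed

lemma tendsto_sqnorm:
  assumes "L2_tendsto M f g"
  shows "(\<lambda>k. sqnorm M (f k)) \<longlonglongrightarrow> sqnorm M g"
  using tendsto_inner_L2[OF assms assms] by (simp add: inner_L2_self tendsto_of_real_iff)

lemma L2_tendsto_unique:
  assumes "L2_tendsto M f g" "L2_tendsto M f h"
  shows "AE x in M. g x = h x"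
proof -
  have "(\<lambda>k. sqnorm M (\<lambda>x. f k x - f k x)) \<longlonglongrightarrow> sqnorm M (\<lambda>x. g x - h x)"
    by (rule tendsto_sqnorm[OF L2_tendsto_diff[OF assms]])
  then have "sqnorm M (\<lambda>x. g x - h x) = 0"
    by (simp add: sqnorm_def LIMSEQ_const_iff)
  moreover have "(\<lambda>x. g x - h x) \<in> L2 M"
    using assms by (auto simp: L2_tendsto_def intro: L2_diff)
  ultimately show ?thesis
    by (simp add: sqnorm_eq_0_iff)
qed

text \<open>Cutting off the small values is the right truncation here: on \<open>{1 / (k + 1) < \<bar>f\<bar>}\<close> one has
  \<open>\<bar>f\<bar> \<le> (k + 1) \<bar>f\<bar>\<^sup>2\<close>, so the truncated function is integrable even if the measure of the
  whole space is infinite.\<close>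

definition trunc :: "('a \<Rightarrow> complex) \<Rightarrow> nat \<Rightarrow> 'a \<Rightarrow> complex" where
  "trunc f k x = (if 1 / real (Suc k) < cmod (f x) then f x else 0)"

lemma trunc_L2:
  assumes "f \<in> L2 M" shows "trunc f k \<in> L2 M"
proof -
  have [measurable]: "f \<in> borel_measurable M"
    using assms by (rule L2_D)
  have m: "trunc f k \<in> borel_measurable M"
    unfolding trunc_def[abs_def] by measurable
  have "integrable M (\<lambda>x. (cmod (trunc f k x))\<^sup>2)"
    by (rule Bochner_Integration.integrable_bound[OF L2_integrable[OF assms]])
       (use m in \<open>auto simp: trunc_def\<close>)
  with m show ?thesis
    by (simp add: L2_def)
qed

lemma integrable_trunc:
  assumes "f \<in> L2 M" shows "integrable M (trunc f k)"
proof (rule Bochner_Integration.integrable_bound)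
  show "integrable M (\<lambda>x. real (Suc k) * (cmod (f x))\<^sup>2)"
    using L2_integrable[OF assms] by (intro integrable_mult_right) auto
  show "trunc f k \<in> borel_measurable M"
    using trunc_L2[OF assms] by (rule L2_D)
  show "AE x in M. norm (trunc f k x) \<le> norm (real (Suc k) * (cmod (f x))\<^sup>2)"
  proof (intro AE_I2)
    fix x
    have "cmod (f x) * 1 \<le> cmod (f x) * (real (Suc k) * cmod (f x))" if "1 / real (Suc k) < cmod (f x)"
      using that by (intro mult_left_mono) (auto simp: field_simps)
    then show "norm (trunc f k x) \<le> norm (real (Suc k) * (cmod (f x))\<^sup>2)"
      by (auto simp: trunc_def power2_eq_square algebra_simps)
  qed
qed

lemma trunc_tendsto:
  assumes "f \<in> L2 M" shows "L2_tendsto M (trunc f) f"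
proof -
  have [measurable]: "f \<in> borel_measurable M" "trunc f k \<in> borel_measurable M" for k
    using assms trunc_L2[OF assms] by (auto intro: L2_D)
  have "(\<lambda>k. \<integral>x. (cmod (trunc f k x - f x))\<^sup>2 \<partial>M) \<longlonglongrightarrow> (\<integral>x. 0 \<partial>M)"
  proof (rule integral_dominated_convergence[where w = "\<lambda>x. (cmod (f x))\<^sup>2"])
    show "AE x in M. (\<lambda>k. (cmod (trunc f k x - f x))\<^sup>2) \<longlonglongrightarrow> 0"
    proof (intro AE_I2)
      fix x
      show "(\<lambda>k. (cmod (trunc f k x - f x))\<^sup>2) \<longlonglongrightarrow> 0"
      proof (cases "f x = 0")
        case False
        have "(\<lambda>k. 1 / real (Suc k)) \<longlonglongrightarrow> 0"
          using LIMSEQ_inverse_real_of_nat by (simp add: inverse_eq_divide)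
        then have "\<forall>\<^sub>F k in sequentially. 1 / real (Suc k) < cmod (f x)"
          using False by (intro order_tendstoD) auto
        then have "\<forall>\<^sub>F k in sequentially. (cmod (trunc f k x - f x))\<^sup>2 = 0"
          by eventually_elim (simp add: trunc_def)
        then show ?thesis
          by (rule tendsto_eventually)
      qed (simp add: trunc_def)
    qed
  qed (use L2_integrable[OF assms] in \<open>auto simp: trunc_def\<close>)
  then show ?thesis
    using assms trunc_L2 by (auto simp: L2_tendsto_def)
qed

text \<open>Completeness of \<open>L\<^sup>2\<close>. Along a subsequence with
  \<open>\<parallel>f\<^bsub>r(k+1)\<^esub> - f\<^bsub>r k\<^esub>\<parallel>\<^sup>2 \<le> 4\<^sup>-\<^sup>k\<close> the increments \<open>d\<^sub>k\<close> satisfy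
  \<open>\<Sum> 2\<^sup>k d\<^sub>k\<^sup>2 < \<infinity>\<close> almost everywhere, and
  \<open>2 d\<^sub>k \<le> 2\<^sup>k d\<^sub>k\<^sup>2 + 2\<^sup>-\<^sup>k\<close> makes the subsequence converge pointwise; Fatou's lemma turns
  its pointwise limit into a limit in square mean of the whole sequence.\<close>

lemma L2_complete:
  assumes L: "\<And>k. f k \<in> L2 M"
    and Cauchy: "\<And>e. 0 < e \<Longrightarrow> \<exists>N. \<forall>m\<ge>N. \<forall>n\<ge>N. sqnorm M (\<lambda>x. f m x - f n x) < e"
  shows "\<exists>g. L2_tendsto M f g"
proof -
  have [measurable]: "f k \<in> borel_measurable M" for k
    using L by (rule L2_D)
  have "\<forall>k. \<exists>N. \<forall>m\<ge>N. \<forall>n\<ge>N. sqnorm M (\<lambda>x. f m x - f n x) < (1/4)^k"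
    using Cauchy by simp
  then obtain N where N: "\<And>k m n. m \<ge> N k \<Longrightarrow> n \<ge> N k \<Longrightarrow> sqnorm M (\<lambda>x. f m x - f n x) < (1/4)^k"
    by metis
  \<comment> \<open>The summand \<open>k\<close> makes \<open>r\<close> tend to infinity, and the sum makes both \<open>r k\<close> and \<open>r (Suc k)\<close>
    dominate \<open>N k\<close>.\<close>
  define r where "r k = k + (\<Sum>i\<le>k. N i)" for k
  have N_le_r: "N k \<le> r k" for k
    unfolding r_def using member_le_sum[of k "{..k}" N] by simp
  have "r k \<le> r (Suc k)" for k
    by (simp add: r_def)
  then have rN: "N k \<le> r k" "N k \<le> r (Suc k)" for k
    using N_le_r[of k] by (auto intro: order_trans)
  define d where "d k x = cmod (f (r (Suc k)) x - f (r k) x)" for k x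
  have [measurable]: "d k \<in> borel_measurable M" for k
    unfolding d_def[abs_def] by measurable
  have int_d: "(\<integral>\<^sup>+x. ennreal (2^k * (d k x)\<^sup>2) \<partial>M) \<le> ennreal ((1/2)^k)" for k
  proof -
    have "(\<integral>\<^sup>+x. ennreal (2^k * (d k x)\<^sup>2) \<partial>M) = ennreal (2^k) * (\<integral>\<^sup>+x. ennreal ((d k x)\<^sup>2) \<partial>M)"
      by (simp add: ennreal_mult' nn_integral_cmult)
    also have "\<dots> = ennreal (2^k * sqnorm M (\<lambda>x. f (r (Suc k)) x - f (r k) x))"
      unfolding d_def using nn_integral_eq_sqnorm[OF L2_diff[OF L L]] by (simp add: ennreal_mult')
    also have "\<dots> \<le> ennreal (2^k * (1/4)^k)"
      using N[OF rN(2,1), of k] by (intro ennreal_leI mult_left_mono) auto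
    also have "(2::real)^k * (1/4)^k = (1/2)^k"
      by (simp flip: power_mult_distrib)
    finally show ?thesis .
  qed
  have "(\<integral>\<^sup>+x. (\<Sum>k. ennreal (2^k * (d k x)\<^sup>2)) \<partial>M) = (\<Sum>k. \<integral>\<^sup>+x. ennreal (2^k * (d k x)\<^sup>2) \<partial>M)"
    by (rule nn_integral_suminf) measurable
  also have "\<dots> \<le> (\<Sum>k. ennreal ((1/2)^k))"
    by (rule suminf_le[OF int_d]) auto
  also have "\<dots> < \<infinity>"
    by (subst suminf_ennreal2) (auto intro: summable_geometric)
  finally have "AE x in M. (\<Sum>k. ennreal (2^k * (d k x)\<^sup>2)) \<noteq> \<infinity>"
    by (intro nn_integral_PInf_AE) auto
  then have conv: "AE x in M. (\<lambda>k. f (r k) x) \<longlonglongrightarrow> lim (\<lambda>k. f (r k) x)"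
  proof eventually_elim
    fix x assume "(\<Sum>k. ennreal (2^k * (d k x)\<^sup>2)) \<noteq> \<infinity>"
    then have s: "summable (\<lambda>k. 2^k * (d k x)\<^sup>2)"
      by (intro summable_suminf_not_top) auto
    have "summable (\<lambda>k. d k x)"
    proof (rule summable_comparison_test')
      show "summable (\<lambda>k. (2^k * (d k x)\<^sup>2 + (1/2)^k) / 2)"
        by (intro summable_divide summable_add s summable_geometric) auto
      fix k :: nat
      have "0 \<le> 2^k * (d k x - (1/2)^k)\<^sup>2"
        by simp
      also have "\<dots> = 2^k * (d k x)\<^sup>2 - 2 * (2^k * (1/2)^k) * d k x + (2^k * (1/2)^k) * (1/2)^k"
        by (simp add: power2_eq_square algebra_simps)
      also have "(2::real)^k * (1/2)^k = 1"
        by (simp flip: power_mult_distrib)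
      finally show "norm (d k x) \<le> (2^k * (d k x)\<^sup>2 + (1/2)^k) / 2"
        by (simp add: d_def)
    qed
    then have "summable (\<lambda>k. f (r (Suc k)) x - f (r k) x)"
      unfolding d_def by (rule summable_norm_cancel)
    then have "(\<lambda>n. \<Sum>k<n. f (r (Suc k)) x - f (r k) x) \<longlonglongrightarrow> (\<Sum>k. f (r (Suc k)) x - f (r k) x)"
      by (rule summable_LIMSEQ)
    then have "(\<lambda>n. f (r n) x - f (r 0) x) \<longlonglongrightarrow> (\<Sum>k. f (r (Suc k)) x - f (r k) x)"
      by (simp add: sum_lessThan_telescope[of "\<lambda>k. f (r k) x"])
    then have "(\<lambda>n. (f (r n) x - f (r 0) x) + f (r 0) x) \<longlonglongrightarrow> (\<Sum>k. f (r (Suc k)) x - f (r k) x) + f (r 0) x"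
      by (intro tendsto_add tendsto_const)
    then have "convergent (\<lambda>k. f (r k) x)"
      by (auto simp: convergent_def)
    then show "(\<lambda>k. f (r k) x) \<longlonglongrightarrow> lim (\<lambda>k. f (r k) x)"
      by (simp add: convergent_LIMSEQ_iff)
  qed
  define g where "g x = lim (\<lambda>k. f (r k) x)" for x
  have [measurable]: "g \<in> borel_measurable M"
    unfolding g_def[abs_def] by measurable
  have bound: "(\<integral>\<^sup>+x. ennreal ((cmod (f n x - g x))\<^sup>2) \<partial>M) \<le> ennreal e"
    if e: "0 < e" and n: "n \<ge> K" and K: "\<forall>m\<ge>K. \<forall>n\<ge>K. sqnorm M (\<lambda>x. f m x - f n x) < e" for e n K
  proof -
    have "(\<integral>\<^sup>+x. ennreal ((cmod (f n x - g x))\<^sup>2) \<partial>M) =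
        (\<integral>\<^sup>+x. liminf (\<lambda>k. ennreal ((cmod (f n x - f (r k) x))\<^sup>2)) \<partial>M)"
    proof (rule nn_integral_cong_AE)
      show "AE x in M. ennreal ((cmod (f n x - g x))\<^sup>2) = liminf (\<lambda>k. ennreal ((cmod (f n x - f (r k) x))\<^sup>2))"
        using conv
      proof eventually_elim
        fix x assume "(\<lambda>k. f (r k) x) \<longlonglongrightarrow> lim (\<lambda>k. f (r k) x)"
        then have "(\<lambda>k. ennreal ((cmod (f n x - f (r k) x))\<^sup>2)) \<longlonglongrightarrow> ennreal ((cmod (f n x - g x))\<^sup>2)"
          unfolding g_def by (intro tendsto_intros)
        then show "ennreal ((cmod (f n x - g x))\<^sup>2) = liminf (\<lambda>k. ennreal ((cmod (f n x - f (r k) x))\<^sup>2))"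
          by (rule lim_imp_Liminf[symmetric, rotated]) simp
      qed
    qed
    also have "\<dots> \<le> liminf (\<lambda>k. \<integral>\<^sup>+x. ennreal ((cmod (f n x - f (r k) x))\<^sup>2) \<partial>M)"
      by (rule nn_integral_liminf) measurable
    also have "\<dots> \<le> ennreal e"
    proof (rule Liminf_le)
      have "(\<integral>\<^sup>+x. ennreal ((cmod (f n x - f (r k) x))\<^sup>2) \<partial>M) \<le> ennreal e" if "k \<ge> K" for k
      proof -
        have "r k \<ge> K"
          using that by (simp add: r_def)
        then show ?thesis
          using K n unfolding nn_integral_eq_sqnorm[OF L2_diff[OF L L]]
          by (intro ennreal_leI less_imp_le) blast
      qed
      then show "\<forall>\<^sub>F k in sequentially. (\<integral>\<^sup>+x. ennreal ((cmod (f n x - f (r k) x))\<^sup>2) \<partial>M) \<le> ennreal e"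
        by (rule eventually_sequentiallyI)
    qed simp
    finally show ?thesis .
  qed
  obtain K where K: "\<forall>m\<ge>K. \<forall>n\<ge>K. sqnorm M (\<lambda>x. f m x - f n x) < 1"
    using Cauchy[of 1] by auto
  have "(\<lambda>x. f K x - g x) \<in> L2 M"
    unfolding L2_iff_nn_integral using bound[OF _ _ K, of K] by (auto intro: le_less_trans)
  from L2_diff[OF L[of K] this] have g: "g \<in> L2 M"
    by simp
  have "(\<lambda>k. sqnorm M (\<lambda>x. f k x - g x)) \<longlonglongrightarrow> 0"
  proof (rule LIMSEQ_I)
    fix e :: real assume e: "0 < e"
    obtain K where K: "\<forall>m\<ge>K. \<forall>n\<ge>K. sqnorm M (\<lambda>x. f m x - f n x) < e / 2"
      using Cauchy[of "e / 2"] e by auto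
    have "norm (sqnorm M (\<lambda>x. f n x - g x) - 0) < e" if "n \<ge> K" for n
    proof -
      have "ennreal (sqnorm M (\<lambda>x. f n x - g x)) \<le> ennreal (e / 2)"
        using bound[OF _ that K] e nn_integral_eq_sqnorm[OF L2_diff[OF L g]] by simp
      then have "sqnorm M (\<lambda>x. f n x - g x) \<le> e / 2"
        using e by (subst (asm) ennreal_le_iff) auto
      then show ?thesis
        using e sqnorm_nonneg[of M "\<lambda>x. f n x - g x"] by simp
    qed
    then show "\<exists>no. \<forall>n\<ge>no. norm (sqnorm M (\<lambda>x. f n x - g x) - 0) < e"
      by blast
  qed
  with g L show ?thesis
    by (auto simp: L2_tendsto_iff)
qed

section \<open>Extending an isometry from integrable functions\<close>

text \<open>An isometry given by a formula that makes sense for integrable functions only. The domain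
  consists of the functions in \<open>L\<^sup>1 \<inter> L\<^sup>2\<close>, which is dense by truncation, and linearity is required
  almost everywhere because the formula may fail on a null set.\<close>

locale dense_isometry =
  fixes M :: "'a measure" and T :: "('a \<Rightarrow> complex) \<Rightarrow> 'a \<Rightarrow> complex"
  assumes T_L2: "f \<in> L2 M \<Longrightarrow> integrable M f \<Longrightarrow> T f \<in> L2 M"
    and T_lincomb: "f \<in> L2 M \<Longrightarrow> integrable M f \<Longrightarrow> g \<in> L2 M \<Longrightarrow> integrable M g \<Longrightarrow>
      AE x in M. T (\<lambda>y. a * f y + b * g y) x = a * T f x + b * T g x"
    and T_inner: "f \<in> L2 M \<Longrightarrow> integrable M f \<Longrightarrow> g \<in> L2 M \<Longrightarrow> integrable M g \<Longrightarrow>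
      inner_L2 M (T f) (T g) = inner_L2 M f g"
begin

lemma T_trunc_L2: "f \<in> L2 M \<Longrightarrow> T (trunc f k) \<in> L2 M"
  by (intro T_L2 trunc_L2 integrable_trunc)

lemma sqnorm_T_diff:
  assumes "f \<in> L2 M" "integrable M f" "g \<in> L2 M" "integrable M g"
  shows "sqnorm M (\<lambda>x. T f x - T g x) = sqnorm M (\<lambda>x. f x - g x)"
proof -
  have d: "(\<lambda>x. f x - g x) \<in> L2 M" "integrable M (\<lambda>x. f x - g x)"
    using assms by (auto intro: L2_diff)
  have L: "T f \<in> L2 M" "T g \<in> L2 M"
    using assms by (auto intro: T_L2)
  have "AE x in M. T (\<lambda>x. f x - g x) x = T f x - T g x"
    using T_lincomb[OF assms, of 1 "-1"] by simp
  then have "sqnorm M (\<lambda>x. T f x - T g x) = sqnorm M (T (\<lambda>x. f x - g x))"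
    by (intro sqnorm_cong_AE L2_D L2_diff L T_L2 d) auto
  also have "\<dots> = sqnorm M (\<lambda>x. f x - g x)"
    using T_inner[OF d d] by (simp only: inner_L2_self of_real_eq_iff)
  finally show ?thesis .
qed

lemma T_trunc_convergent:
  assumes f: "f \<in> L2 M"
  shows "\<exists>g. L2_tendsto M (\<lambda>k. T (trunc f k)) g"
proof (rule L2_complete[OF T_trunc_L2[OF f]])
  fix e :: real assume e: "0 < e"
  have "(\<lambda>k. sqnorm M (\<lambda>x. trunc f k x - f x)) \<longlonglongrightarrow> 0"
    using trunc_tendsto[OF f] by (simp add: L2_tendsto_iff)
  then have "\<forall>\<^sub>F k in sequentially. sqnorm M (\<lambda>x. trunc f k x - f x) < e / 4"
    using e by (intro order_tendstoD) auto
  then obtain N where N: "\<And>k. k \<ge> N \<Longrightarrow> sqnorm M (\<lambda>x. trunc f k x - f x) < e / 4"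
    by (auto simp: eventually_sequentially)
  have "sqnorm M (\<lambda>x. T (trunc f m) x - T (trunc f n) x) < e" if "m \<ge> N" "n \<ge> N" for m n
  proof -
    have "sqnorm M (\<lambda>x. T (trunc f m) x - T (trunc f n) x) = sqnorm M (\<lambda>x. trunc f m x - trunc f n x)"
      by (rule sqnorm_T_diff[OF trunc_L2[OF f] integrable_trunc[OF f] trunc_L2[OF f] integrable_trunc[OF f]])
    also have "\<dots> = sqnorm M (\<lambda>x. (trunc f m x - f x) + (f x - trunc f n x))"
      by simp
    also have "\<dots> \<le> 2 * sqnorm M (\<lambda>x. trunc f m x - f x) + 2 * sqnorm M (\<lambda>x. f x - trunc f n x)"
      by (intro sqnorm_add_le L2_diff trunc_L2 f)
    also have "\<dots> < 2 * (e / 4) + 2 * (e / 4)"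
      using N[OF that(1)] N[OF that(2)] by (simp add: sqnorm_diff_commute[of M f])
    finally show ?thesis
      by simp
  qed
  then show "\<exists>N. \<forall>m\<ge>N. \<forall>n\<ge>N. sqnorm M (\<lambda>x. T (trunc f m) x - T (trunc f n) x) < e"
    by blast
qed

text \<open>The images of the truncations converge because \<open>T\<close> is isometric and \<open>L\<^sup>2\<close> is complete;
  sending a function to this limit gives an isometric map, and isometric maps are continuous.\<close>

theorem ex_L2_extension: "\<exists>U. L2_extension M T U"
proof -
  define U where "U f = (SOME g. L2_tendsto M (\<lambda>k. T (trunc f k)) g)" for f
  have U: "L2_tendsto M (\<lambda>k. T (trunc f k)) (U f)" if "f \<in> L2 M" for f
    unfolding U_def using T_trunc_convergent[OF that] by (rule someI_ex)
  have U_L2: "U f \<in> L2 M" if "f \<in> L2 M" for f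
    using U[OF that] by (simp add: L2_tendsto_def)
  have U_eq: "AE x in M. U f x = T f x" if f: "f \<in> L2 M" "integrable M f" for f
  proof (rule L2_tendsto_unique[OF U[OF f(1)]])
    show "L2_tendsto M (\<lambda>k. T (trunc f k)) (T f)"
      using trunc_tendsto[OF f(1)] T_trunc_L2[OF f(1)] T_L2[OF f]
        sqnorm_T_diff[OF trunc_L2[OF f(1)] integrable_trunc[OF f(1)] f]
      by (simp add: L2_tendsto_iff)
  qed
  have U_isometric: "sqnorm M (\<lambda>x. U f x - U g x) = sqnorm M (\<lambda>x. f x - g x)"
    if f: "f \<in> L2 M" and g: "g \<in> L2 M" for f g
  proof (rule LIMSEQ_unique)
    show "(\<lambda>k. sqnorm M (\<lambda>x. T (trunc f k) x - T (trunc g k) x)) \<longlonglongrightarrow> sqnorm M (\<lambda>x. U f x - U g x)"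
      by (rule tendsto_sqnorm[OF L2_tendsto_diff[OF U[OF f] U[OF g]]])
    show "(\<lambda>k. sqnorm M (\<lambda>x. T (trunc f k) x - T (trunc g k) x)) \<longlonglongrightarrow> sqnorm M (\<lambda>x. f x - g x)"
      using tendsto_sqnorm[OF L2_tendsto_diff[OF trunc_tendsto[OF f] trunc_tendsto[OF g]]]
      by (simp add: sqnorm_T_diff f g trunc_L2 integrable_trunc)
  qed
  have "L2_tendsto M (\<lambda>k. U (f k)) (U g)" if "L2_tendsto M f g" for f g
    using that U_isometric by (simp add: L2_tendsto_iff U_L2)
  then have "L2_extension M T U"
    using U_L2 U_eq by (simp add: L2_extension_def)
  then show ?thesis
    by (rule exI[of _ U])
qed

context
  fixes U assumes U: "L2_extension M T U"
begin

lemma extension_L2: "f \<in> L2 M \<Longrightarrow> U f \<in> L2 M"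
  using U by (simp add: L2_extension_def)

lemma extension_eq: "f \<in> L2 M \<Longrightarrow> integrable M f \<Longrightarrow> AE x in M. U f x = T f x"
  using U by (simp add: L2_extension_def)

lemma extension_tendsto: "L2_tendsto M f g \<Longrightarrow> L2_tendsto M (\<lambda>k. U (f k)) (U g)"
  using U by (simp add: L2_extension_def)

lemma T_trunc_tendsto_extension:
  assumes "f \<in> L2 M" shows "L2_tendsto M (\<lambda>k. T (trunc f k)) (U f)"
  by (rule L2_tendsto_cong_AE[OF extension_tendsto[OF trunc_tendsto[OF assms]] T_trunc_L2[OF assms]
      extension_eq[OF trunc_L2[OF assms] integrable_trunc[OF assms]]])

text \<open>An arbitrary extension is determined by its values on truncations, so that all properties of
  \<open>T\<close> are inherited through \<open>T_trunc_tendsto_extension\<close>, whichever extension is chosen.\<close>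

lemma extension_inner:
  assumes f: "f \<in> L2 M" and g: "g \<in> L2 M"
  shows "inner_L2 M (U f) (U g) = inner_L2 M f g"
proof (rule LIMSEQ_unique)
  show "(\<lambda>k. inner_L2 M (T (trunc f k)) (T (trunc g k))) \<longlonglongrightarrow> inner_L2 M (U f) (U g)"
    by (rule tendsto_inner_L2[OF T_trunc_tendsto_extension[OF f] T_trunc_tendsto_extension[OF g]])
  show "(\<lambda>k. inner_L2 M (T (trunc f k)) (T (trunc g k))) \<longlonglongrightarrow> inner_L2 M f g"
    using tendsto_inner_L2[OF trunc_tendsto[OF f] trunc_tendsto[OF g]]
    by (simp add: T_inner f g trunc_L2 integrable_trunc)
qed

lemma extension_cong_AE:
  assumes "f \<in> L2 M" "g \<in> L2 M" "AE x in M. f x = g x"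
  shows "AE x in M. U f x = U g x"
proof (rule L2_tendsto_unique[OF L2_tendsto_const])
  have "AE x in M. g x = f x"
    using assms(3) by eventually_elim simp
  then have "L2_tendsto M (\<lambda>k::nat. f) g"
    by (intro L2_tendsto_cong_AE[OF L2_tendsto_const[OF assms(2)] assms(1)])
  then show "L2_tendsto M (\<lambda>k. U f) (U g)"
    by (rule extension_tendsto)
qed (rule extension_L2[OF assms(1)])

lemma extension_lincomb:
  assumes f: "f \<in> L2 M" and g: "g \<in> L2 M"
  shows "AE x in M. U (\<lambda>y. a * f y + b * g y) x = a * U f x + b * U g x"
proof (rule L2_tendsto_unique)
  let ?h = "\<lambda>k y. a * trunc f k y + b * trunc g k y"
  have h: "?h k \<in> L2 M" "integrable M (?h k)" for k
    using f g by (auto intro!: L2_lincomb trunc_L2 integrable_trunc)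
  have "L2_tendsto M ?h (\<lambda>y. a * f y + b * g y)"
    by (intro L2_tendsto_lincomb trunc_tendsto f g)
  then show "L2_tendsto M (\<lambda>k. U (?h k)) (U (\<lambda>y. a * f y + b * g y))"
    by (rule extension_tendsto)
  show "L2_tendsto M (\<lambda>k. U (?h k)) (\<lambda>x. a * U f x + b * U g x)"
  proof (rule L2_tendsto_cong_AE)
    show "L2_tendsto M (\<lambda>k x. a * T (trunc f k) x + b * T (trunc g k) x) (\<lambda>x. a * U f x + b * U g x)"
      by (intro L2_tendsto_lincomb T_trunc_tendsto_extension f g)
    show "AE x in M. a * T (trunc f k) x + b * T (trunc g k) x = U (?h k) x" for k
      using extension_eq[OF h, of k]
        T_lincomb[OF trunc_L2[OF f] integrable_trunc[OF f] trunc_L2[OF g] integrable_trunc[OF g], of a k b k]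
      by eventually_elim simp
  qed (rule extension_L2[OF h(1)])
qed

text \<open>If \<open>T\<close> is symmetric, so is \<open>U\<close>, and a symmetric isometry is an involution:
  \<open>\<langle>g, U (U f)\<rangle> = \<langle>U g, U f\<rangle> = \<langle>g, f\<rangle>\<close> for all \<open>g\<close>. Surjectivity is thus obtained without
  any inversion formula.\<close>

theorem extension_unitary:
  assumes sym: "\<And>f g. f \<in> L2 M \<Longrightarrow> integrable M f \<Longrightarrow> g \<in> L2 M \<Longrightarrow> integrable M g \<Longrightarrow>
      inner_L2 M (T f) g = inner_L2 M f (T g)"
  shows "unitary_on_L2 M U"
proof -
  have U_sym: "inner_L2 M (U f) g = inner_L2 M f (U g)" if f: "f \<in> L2 M" and g: "g \<in> L2 M" for f g
  proof (rule LIMSEQ_unique)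
    show "(\<lambda>k. inner_L2 M (T (trunc f k)) (trunc g k)) \<longlonglongrightarrow> inner_L2 M (U f) g"
      by (rule tendsto_inner_L2[OF T_trunc_tendsto_extension[OF f] trunc_tendsto[OF g]])
    show "(\<lambda>k. inner_L2 M (T (trunc f k)) (trunc g k)) \<longlonglongrightarrow> inner_L2 M f (U g)"
      using tendsto_inner_L2[OF trunc_tendsto[OF f] T_trunc_tendsto_extension[OF g]]
      by (simp add: sym f g trunc_L2 integrable_trunc)
  qed
  have U_U: "AE x in M. U (U f) x = f x" if f: "f \<in> L2 M" for f
  proof -
    have UU: "U (U f) \<in> L2 M"
      using f by (intro extension_L2)
    define g where "g x = U (U f) x - f x" for x
    have g: "g \<in> L2 M"
      unfolding g_def[abs_def] by (rule L2_diff[OF UU f])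
    have "inner_L2 M g g = inner_L2 M g (U (U f)) - inner_L2 M g f"
      using inner_L2_diff_right[OF UU f g] by (simp only: g_def[abs_def, symmetric])
    also have "inner_L2 M g (U (U f)) = inner_L2 M (U g) (U f)"
      by (rule U_sym[OF g extension_L2[OF f], symmetric])
    also have "\<dots> = inner_L2 M g f"
      by (rule extension_inner[OF g f])
    finally have "sqnorm M g = 0"
      by (simp add: inner_L2_self)
    then show ?thesis
      using sqnorm_eq_0_iff[OF g] by (simp add: g_def)
  qed
  have "\<exists>f\<in>L2 M. AE x in M. U f x = h x" if "h \<in> L2 M" for h
    using U_U[OF that] extension_L2[OF that] by blast
  then show ?thesis
    unfolding unitary_on_L2_def
    by (simp add: extension_L2 extension_cong_AE extension_lincomb extension_inner)
qed

end

end

section \<open>Constructions of unitary operators\<close>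

lemma unitary_on_L2_compose:
  assumes U: "unitary_on_L2 M U" and V: "unitary_on_L2 M V"
  shows "unitary_on_L2 M (U \<circ> V)"
proof -
  have L2: "W f \<in> L2 M" if "unitary_on_L2 M W" "f \<in> L2 M" for W f
    using that by (simp add: unitary_on_L2_def)
  have cong: "AE x in M. W f x = W g x"
    if "unitary_on_L2 M W" "f \<in> L2 M" "g \<in> L2 M" "AE x in M. f x = g x" for W f g
    using that by (simp add: unitary_on_L2_def)
  have lin: "AE x in M. W (\<lambda>y. a * f y + b * g y) x = a * W f x + b * W g x"
    if "unitary_on_L2 M W" "f \<in> L2 M" "g \<in> L2 M" for W f g a b
    using that by (simp add: unitary_on_L2_def)
  have inner: "inner_L2 M (W f) (W g) = inner_L2 M f g"
    if "unitary_on_L2 M W" "f \<in> L2 M" "g \<in> L2 M" for W f g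
    using that by (simp add: unitary_on_L2_def)
  have surj: "\<exists>f\<in>L2 M. AE x in M. W f x = h x" if "unitary_on_L2 M W" "h \<in> L2 M" for W h
    using that by (simp add: unitary_on_L2_def)
  have comp_lin: "AE x in M. U (V (\<lambda>y. a * f y + b * g y)) x = a * U (V f) x + b * U (V g) x"
    if f: "f \<in> L2 M" and g: "g \<in> L2 M" for f g a b
  proof -
    have "AE x in M. U (V (\<lambda>y. a * f y + b * g y)) x = U (\<lambda>y. a * V f y + b * V g y) x"
      by (intro cong[OF U] L2[OF V] L2_lincomb f g lin[OF V])
    with lin[OF U L2[OF V f] L2[OF V g], of a b] show ?thesis
      by eventually_elim simp
  qed
  have comp_surj: "\<exists>f\<in>L2 M. AE x in M. U (V f) x = h x" if h: "h \<in> L2 M" for h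
  proof -
    obtain g where g: "g \<in> L2 M" "AE x in M. U g x = h x"
      using surj[OF U h] by blast
    obtain f where f: "f \<in> L2 M" "AE x in M. V f x = g x"
      using surj[OF V g(1)] by blast
    have "AE x in M. U (V f) x = h x"
      using cong[OF U L2[OF V f(1)] g(1) f(2)] g(2) by eventually_elim simp
    with f(1) show ?thesis
      by blast
  qed
  show ?thesis
    unfolding unitary_on_L2_def o_def
    using comp_lin comp_surj
    by (simp add: L2[OF U] L2[OF V] cong[OF U] cong[OF V] inner[OF U] inner[OF V])
qed

lemma unitary_on_L2_measure_preserving:
  assumes t: "t \<in> measurable M M" "distr M M t = M"
    and t': "t' \<in> measurable M M" "distr M M t' = M"
    and inverse: "\<And>x. t' (t x) = x"
  shows "unitary_on_L2 M (\<lambda>f x. f (t x))"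
proof -
  have L2: "(\<lambda>x. f (u x)) \<in> L2 M" if f: "f \<in> L2 M" and u: "u \<in> measurable M M" "distr M M u = M" for f u
  proof -
    have "integrable (distr M M u) (\<lambda>x. (cmod (f x))\<^sup>2)"
      using L2_integrable[OF f] by (simp only: u(2))
    then have "integrable M (\<lambda>x. (cmod (f (u x)))\<^sup>2)"
      by (rule integrable_distr[OF u(1)])
    then show ?thesis
      using measurable_compose[OF u(1) L2_D[OF f]] by (simp add: L2_def)
  qed
  have AE: "AE x in M. f (t x) = g (t x)" if eq: "AE x in M. f x = g x" for f g :: "'a \<Rightarrow> complex"
  proof -
    have "AE x in distr M M t. f x = g x"
      using eq by (simp only: t(2))
    then show ?thesis
      by (rule AE_distrD[OF t(1)])
  qed
  have inner: "inner_L2 M (\<lambda>x. f (t x)) (\<lambda>x. g (t x)) = inner_L2 M f g"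
    if "f \<in> L2 M" "g \<in> L2 M" for f g
  proof -
    have "inner_L2 (distr M M t) f g = inner_L2 M (\<lambda>x. f (t x)) (\<lambda>x. g (t x))"
      unfolding pairing_def
      by (rule integral_distr[OF t(1) borel_measurable_integrable[OF integrable_cnj_mult[OF that]]])
    then show ?thesis
      by (simp only: t(2))
  qed
  have surj: "\<exists>f\<in>L2 M. AE x in M. f (t x) = h x" if h: "h \<in> L2 M" for h
  proof
    show "(\<lambda>x. h (t' x)) \<in> L2 M"
      by (rule L2[OF h t'])
    show "AE x in M. h (t' (t x)) = h x"
      by (simp add: inverse)
  qed
  show ?thesis
    unfolding unitary_on_L2_def
  proof (intro conjI ballI allI impI)
    show "(\<lambda>x. f (t x)) \<in> L2 M" if "f \<in> L2 M" for f
      by (rule L2[OF that t])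
    show "AE x in M. f (t x) = g (t x)" if "AE x in M. f x = g x" for f g :: "'a \<Rightarrow> complex"
      by (rule AE[OF that])
    show "inner_L2 M (\<lambda>x. f (t x)) (\<lambda>x. g (t x)) = inner_L2 M f g" if "f \<in> L2 M" "g \<in> L2 M" for f g
      by (rule inner[OF that])
    show "\<exists>f\<in>L2 M. AE x in M. f (t x) = h x" if "h \<in> L2 M" for h
      by (rule surj[OF that])
  qed simp
qed

section \<open>Fibrewise integration over a base that need not be sigma-finite\<close>

lemma sets_product_measure: "sets (product_measure dX d\<sigma>) = sets (dX \<Otimes>\<^sub>M d\<sigma>)"
  by (simp add: product_measure_def)

lemma measurable_fibre:
  assumes "f \<in> measurable (dX \<Otimes>\<^sub>M d\<sigma>) N"
  shows "(\<lambda>(s, X). f (X, s)) \<in> measurable (d\<sigma> \<Otimes>\<^sub>M dX) N"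
  using assms by measurable

context
  fixes dX :: "'x measure" and d\<sigma> :: "'s measure"
  assumes dX: "sigma_finite_measure dX"
begin

interpretation dX: sigma_finite_measure dX
  by (rule dX)

text \<open>For nonnegative functions, integrating over \<open>\<Xi>\<close> first is the definition of the product
  measure. Everything about fibres is derived from this identity.\<close>

lemma nn_integral_product_measure:
  assumes f: "f \<in> borel_measurable (dX \<Otimes>\<^sub>M d\<sigma>)"
  shows "(\<integral>\<^sup>+z. f z \<partial>product_measure dX d\<sigma>) = (\<integral>\<^sup>+s. \<integral>\<^sup>+X. f (X, s) \<partial>dX \<partial>d\<sigma>)"
proof -
  have "(\<integral>\<^sup>+z. f z \<partial>product_measure dX d\<sigma>) = (\<integral>\<^sup>+z. (case z of (s, X) \<Rightarrow> f (X, s)) \<partial>(d\<sigma> \<Otimes>\<^sub>M dX))"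
    unfolding product_measure_def
    using f by (subst nn_integral_distr[OF measurable_pair_swap']) (simp_all add: case_prod_unfold)
  then show ?thesis
    using dX.nn_integral_fst[OF measurable_fibre[OF f]] by simp
qed

lemma borel_measurable_nn_integral_fibre:
  assumes f: "f \<in> borel_measurable (dX \<Otimes>\<^sub>M d\<sigma>)"
  shows "(\<lambda>s. \<integral>\<^sup>+X. f (X, s) \<partial>dX) \<in> borel_measurable d\<sigma>"
  using dX.borel_measurable_nn_integral_fst[OF measurable_fibre[OF f]] by simp

lemma AE_product_eqI:
  fixes f g :: "'x \<times> 's \<Rightarrow> complex"
  assumes [measurable]: "f \<in> borel_measurable (dX \<Otimes>\<^sub>M d\<sigma>)" "g \<in> borel_measurable (dX \<Otimes>\<^sub>M d\<sigma>)"
    and eq: "AE s in d\<sigma>. AE X in dX. f (X, s) = g (X, s)"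
  shows "AE z in product_measure dX d\<sigma>. f z = g z"
proof -
  have "(\<integral>\<^sup>+z. ennreal (cmod (f z - g z)) \<partial>product_measure dX d\<sigma>) =
      (\<integral>\<^sup>+s. \<integral>\<^sup>+X. ennreal (cmod (f (X, s) - g (X, s))) \<partial>dX \<partial>d\<sigma>)"
    by (rule nn_integral_product_measure) measurable
  also have "\<dots> = (\<integral>\<^sup>+s. 0 \<partial>d\<sigma>)"
  proof (rule nn_integral_cong_AE)
    show "AE s in d\<sigma>. (\<integral>\<^sup>+X. ennreal (cmod (f (X, s) - g (X, s))) \<partial>dX) = 0"
      using eq
    proof eventually_elim
      fix s assume "AE X in dX. f (X, s) = g (X, s)"
      then have "(\<integral>\<^sup>+X. ennreal (cmod (f (X, s) - g (X, s))) \<partial>dX) = (\<integral>\<^sup>+X. 0 \<partial>dX)"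
        by (intro nn_integral_cong_AE) auto
      then show "(\<integral>\<^sup>+X. ennreal (cmod (f (X, s) - g (X, s))) \<partial>dX) = 0"
        by simp
    qed
  qed
  finally have "(\<integral>\<^sup>+z. ennreal (cmod (f z - g z)) \<partial>product_measure dX d\<sigma>) = 0"
    by simp
  moreover have "(\<lambda>z. ennreal (cmod (f z - g z))) \<in> borel_measurable (product_measure dX d\<sigma>)"
    by (subst measurable_cong_sets[OF sets_product_measure refl]) measurable
  ultimately show ?thesis
    by (simp add: nn_integral_0_iff_AE)
qed

lemma AE_integrable_fibre:
  fixes h :: "'x \<times> 's \<Rightarrow> 'b::{banach, second_countable_topology}"
  assumes h: "integrable (product_measure dX d\<sigma>) h"
  shows "AE s in d\<sigma>. integrable dX (\<lambda>X. h (X, s))"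
proof -
  have m[measurable]: "h \<in> borel_measurable (dX \<Otimes>\<^sub>M d\<sigma>)"
    using borel_measurable_integrable[OF h] by (simp add: measurable_cong_sets[OF sets_product_measure refl])
  have "(\<integral>\<^sup>+s. \<integral>\<^sup>+X. ennreal (norm (h (X, s))) \<partial>dX \<partial>d\<sigma>) < \<infinity>"
    using h unfolding integrable_iff_bounded by (subst (asm) nn_integral_product_measure) auto
  then have "AE s in d\<sigma>. (\<integral>\<^sup>+X. ennreal (norm (h (X, s))) \<partial>dX) \<noteq> \<infinity>"
    by (intro nn_integral_PInf_AE borel_measurable_nn_integral_fibre) auto
  moreover have "AE s in d\<sigma>. s \<in> space d\<sigma>"
    by (rule AE_space)
  ultimately show ?thesis
  proof eventually_elim
    case (elim s)
    then have "(\<lambda>X. h (X, s)) \<in> borel_measurable dX"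
      using measurable_compose[OF measurable_Pair2'[of s d\<sigma> dX] m] by simp
    with elim show ?case
      by (simp add: integrable_iff_bounded less_top)
  qed
qed

lemma AE_L2_fibre:
  assumes F: "F \<in> L2 (product_measure dX d\<sigma>)"
  shows "AE s in d\<sigma>. (\<lambda>X. F (X, s)) \<in> L2 dX"
proof -
  have m: "F \<in> borel_measurable (dX \<Otimes>\<^sub>M d\<sigma>)"
    using L2_D[OF F] by (simp add: measurable_cong_sets[OF sets_product_measure refl])
  have "AE s in d\<sigma>. integrable dX (\<lambda>X. (cmod (F (X, s)))\<^sup>2)"
    using AE_integrable_fibre[OF L2_integrable[OF F]] by simp
  moreover have "AE s in d\<sigma>. s \<in> space d\<sigma>"
    by (rule AE_space)
  ultimately show ?thesis
  proof eventually_elim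
    case (elim s)
    then show ?case
      using measurable_compose[OF measurable_Pair2'[of s d\<sigma> dX] m] by (simp add: L2_def)
  qed
qed

text \<open>The instance of Fubini's theorem behind all identities between integrals over the product. It
  holds over an arbitrary base, as one sees by comparing the integrals of the positive and negative parts, each of which is an iterated
  integral by the very definition of the product measure.\<close>

lemma integral_product_measure_eq_0_real:
  fixes h :: "'x \<times> 's \<Rightarrow> real"
  assumes h: "integrable (product_measure dX d\<sigma>) h"
    and fibre: "AE s in d\<sigma>. (\<integral>X. h (X, s) \<partial>dX) = 0"
  shows "(\<integral>z. h z \<partial>product_measure dX d\<sigma>) = 0"
proof -
  have m[measurable]: "h \<in> borel_measurable (dX \<Otimes>\<^sub>M d\<sigma>)"
    using borel_measurable_integrable[OF h] by (simp add: measurable_cong_sets[OF sets_product_measure refl])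
  have "(\<integral>\<^sup>+z. ennreal (h z) \<partial>product_measure dX d\<sigma>) = (\<integral>\<^sup>+s. \<integral>\<^sup>+X. ennreal (h (X, s)) \<partial>dX \<partial>d\<sigma>)"
    by (rule nn_integral_product_measure) measurable
  also have "\<dots> = (\<integral>\<^sup>+s. \<integral>\<^sup>+X. ennreal (- h (X, s)) \<partial>dX \<partial>d\<sigma>)"
  proof (rule nn_integral_cong_AE)
    show "AE s in d\<sigma>. (\<integral>\<^sup>+X. ennreal (h (X, s)) \<partial>dX) = (\<integral>\<^sup>+X. ennreal (- h (X, s)) \<partial>dX)"
      using fibre AE_integrable_fibre[OF h]
    proof eventually_elim
      fix s assume 0: "(\<integral>X. h (X, s) \<partial>dX) = 0" and int: "integrable dX (\<lambda>X. h (X, s))"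
      have "(\<integral>\<^sup>+X. ennreal (h (X, s)) \<partial>dX) < top" "(\<integral>\<^sup>+X. ennreal (- h (X, s)) \<partial>dX) < top"
        using int by (auto simp: real_integrable_def less_top)
      moreover have "enn2real (\<integral>\<^sup>+X. ennreal (h (X, s)) \<partial>dX) = enn2real (\<integral>\<^sup>+X. ennreal (- h (X, s)) \<partial>dX)"
        using real_lebesgue_integral_def[OF int] 0 by simp
      ultimately show "(\<integral>\<^sup>+X. ennreal (h (X, s)) \<partial>dX) = (\<integral>\<^sup>+X. ennreal (- h (X, s)) \<partial>dX)"
        by (metis ennreal_enn2real)
    qed
  qed
  also have "\<dots> = (\<integral>\<^sup>+z. ennreal (- h z) \<partial>product_measure dX d\<sigma>)"
    by (rule nn_integral_product_measure[symmetric]) measurable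
  finally show ?thesis
    using real_lebesgue_integral_def[OF h] by simp
qed

lemma integral_product_measure_eq_0:
  fixes h :: "'x \<times> 's \<Rightarrow> complex"
  assumes h: "integrable (product_measure dX d\<sigma>) h"
    and fibre: "AE s in d\<sigma>. (\<integral>X. h (X, s) \<partial>dX) = 0"
  shows "(\<integral>z. h z \<partial>product_measure dX d\<sigma>) = 0"
proof -
  have "AE s in d\<sigma>. (\<integral>X. Re (h (X, s)) \<partial>dX) = 0" "AE s in d\<sigma>. (\<integral>X. Im (h (X, s)) \<partial>dX) = 0"
    using fibre AE_integrable_fibre[OF h] by (eventually_elim, simp)+
  then have "(\<integral>z. Re (h z) \<partial>product_measure dX d\<sigma>) = 0" "(\<integral>z. Im (h z) \<partial>product_measure dX d\<sigma>) = 0"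
    using h by (intro integral_product_measure_eq_0_real; simp)+
  then show ?thesis
    using h by (simp add: complex_eq_iff)
qed

text \<open>The device by which identities between scalar products are lifted from the fibres
  \<open>F(\<cdot>, s) \<in> L\<^sup>2(\<Xi>)\<close> to \<open>L\<^sup>2(\<Xi> \<times> \<Sigma>)\<close>.\<close>

lemma inner_L2_product_eqI:
  assumes L: "F \<in> L2 (product_measure dX d\<sigma>)" "G \<in> L2 (product_measure dX d\<sigma>)"
      "F' \<in> L2 (product_measure dX d\<sigma>)" "G' \<in> L2 (product_measure dX d\<sigma>)"
    and eq: "AE s in d\<sigma>. inner_L2 dX (\<lambda>X. F (X, s)) (\<lambda>X. G (X, s)) =
      inner_L2 dX (\<lambda>X. F' (X, s)) (\<lambda>X. G' (X, s))"
  shows "inner_L2 (product_measure dX d\<sigma>) F G = inner_L2 (product_measure dX d\<sigma>) F' G'"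
proof -
  let ?\<nu> = "product_measure dX d\<sigma>"
  have int: "integrable ?\<nu> (\<lambda>z. cnj (F z) * G z)" "integrable ?\<nu> (\<lambda>z. cnj (F' z) * G' z)"
    using L by (auto intro: integrable_cnj_mult)
  have "(\<integral>z. cnj (F z) * G z - cnj (F' z) * G' z \<partial>?\<nu>) = 0"
  proof (rule integral_product_measure_eq_0)
    show "integrable ?\<nu> (\<lambda>z. cnj (F z) * G z - cnj (F' z) * G' z)"
      using int by simp
    show "AE s in d\<sigma>. (\<integral>X. cnj (F (X, s)) * G (X, s) - cnj (F' (X, s)) * G' (X, s) \<partial>dX) = 0"
      using eq AE_integrable_fibre[OF int(1)] AE_integrable_fibre[OF int(2)]
      by eventually_elim (simp add: pairing_def)
  qed
  then show ?thesis
    using int by (simp add: pairing_def)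
qed

end

section \<open>The partial symplectic Fourier transform\<close>

lemma sigma_finite_normalized_lebesgue:
  assumes "normalized_lebesgue \<omega> dX"
  shows "sigma_finite_measure dX"
proof -
  obtain c :: real where dX: "dX = scale_measure (ennreal c) lborel"
    using assms by (auto simp: normalized_lebesgue_def)
  obtain A :: "'a set set" where "countable A" "A \<subseteq> sets lborel" "\<Union>A = space lborel"
    "\<forall>a\<in>A. emeasure lborel a \<noteq> \<infinity>"
    using lborel.sigma_finite_countable by blast
  then show ?thesis
    unfolding dX by (intro sigma_finite_measure.intro exI[of _ A])
      (auto simp: space_scale_measure ennreal_mult_eq_top_iff)
qed

lemma sets_normalized_lebesgue:
  assumes "normalized_lebesgue \<omega> dX"
  shows "sets dX = sets borel"
  using assms by (auto simp: normalized_lebesgue_def)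

context
  fixes \<omega> :: "'x::euclidean_space \<Rightarrow> 'x \<Rightarrow> real" and dX :: "'x measure"
  assumes \<omega>: "symplectic_form \<omega>" and dX: "normalized_lebesgue \<omega> dX"
begin

interpretation dX: sigma_finite_measure dX
  by (rule sigma_finite_normalized_lebesgue[OF dX])

interpretation dXdX: pair_sigma_finite dX dX
  by unfold_locales

lemma symplectic_form_antisym: "\<omega> X Y = - \<omega> Y X"
proof -
  have b: "bilinear \<omega>" and z: "\<And>X. \<omega> X X = 0"
    using \<omega> by (auto simp: symplectic_form_def)
  have "0 = \<omega> (X + Y) (X + Y)"
    by (simp add: z)
  also have "\<dots> = \<omega> X Y + \<omega> Y X"
    unfolding bilinear_ladd[OF b] bilinear_radd[OF b] by (simp add: z)
  finally show ?thesis
    by simp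
qed

lemma borel_measurable_symplectic_form:
  assumes f: "f \<in> measurable M dX" and g: "g \<in> measurable M dX"
  shows "(\<lambda>x. \<omega> (f x) (g x)) \<in> borel_measurable M"
proof -
  have *: "f \<in> borel_measurable M" "g \<in> borel_measurable M"
    using f g by (simp_all add: measurable_cong_sets[OF refl sets_normalized_lebesgue[OF dX]])
  have "bounded_bilinear \<omega>"
    using \<omega> by (simp add: symplectic_form_def bilinear_conv_bounded_bilinear)
  then have "continuous_on UNIV (\<lambda>p. \<omega> (fst p) (snd p))"
    by (rule bounded_bilinear.continuous_on)
      (rule continuous_on_fst[OF continuous_on_id], rule continuous_on_snd[OF continuous_on_id])
  with * show ?thesis
    by (rule borel_measurable_continuous_Pair)
qed

lemma borel_measurable_kernel:
  "(\<lambda>(X, Y). exp (- (\<i> * of_real (\<omega> X Y)))) \<in> borel_measurable (dX \<Otimes>\<^sub>M dX)"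
proof -
  note borel_measurable_symplectic_form[measurable]
  show ?thesis by measurable
qed

lemma cmod_kernel: "cmod (exp (- (\<i> * of_real r))) = 1"
  using norm_exp_i_times[of "- r"] by simp

lemma borel_measurable_symplectic_fourier:
  assumes [measurable]: "a \<in> borel_measurable dX"
  shows "symplectic_fourier \<omega> dX a \<in> borel_measurable dX"
proof -
  note borel_measurable_symplectic_form[measurable]
  show ?thesis
    unfolding symplectic_fourier_def[abs_def] by measurable
qed

lemma borel_measurable_partial_fourier:
  assumes [measurable]: "F \<in> borel_measurable (dX \<Otimes>\<^sub>M d\<sigma>)"
  shows "partial_fourier \<omega> dX F \<in> borel_measurable (dX \<Otimes>\<^sub>M d\<sigma>)"
proof -
  note borel_measurable_symplectic_form[measurable]
  show ?thesis
    unfolding partial_fourier_def symplectic_fourier_def by measurable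
qed

text \<open>The normalization of \<open>dX\<close> speaks of the extension to \<open>L\<^sup>2\<close>, but it makes the Fourier integral
  itself isometric on \<open>L\<^sup>1 \<inter> L\<^sup>2\<close>. In this form it can be applied in each fibre, where a choice of
  extension need not be measurable in the base variable.\<close>

lemma symplectic_fourier_L2_inner:
  assumes a: "a \<in> L2 dX" "integrable dX a" and b: "b \<in> L2 dX" "integrable dX b"
  shows "symplectic_fourier \<omega> dX a \<in> L2 dX"
    and "inner_L2 dX (symplectic_fourier \<omega> dX a) (symplectic_fourier \<omega> dX b) = inner_L2 dX a b"
proof -
  let ?F = "symplectic_fourier \<omega> dX"
  obtain U where U: "L2_extension dX ?F U" "unitary_on_L2 dX U"
    using dX by (auto simp: normalized_lebesgue_def)
  have m: "?F a \<in> borel_measurable dX" "?F b \<in> borel_measurable dX"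
    using a b by (auto intro!: borel_measurable_symplectic_fourier)
  have L: "U a \<in> L2 dX" "U b \<in> L2 dX"
    using U(1) a b by (auto simp: L2_extension_def)
  have eq: "AE x in dX. U a x = ?F a x" "AE x in dX. U b x = ?F b x"
    using U(1) a b by (auto simp: L2_extension_def)
  have "(\<integral>\<^sup>+x. ennreal ((cmod (?F a x))\<^sup>2) \<partial>dX) = (\<integral>\<^sup>+x. ennreal ((cmod (U a x))\<^sup>2) \<partial>dX)"
    using eq(1) by (intro nn_integral_cong_AE) auto
  with L(1) m(1) show "?F a \<in> L2 dX"
    by (simp add: L2_iff_nn_integral)
  have "inner_L2 dX (?F a) (?F b) = inner_L2 dX (U a) (U b)"
    using eq by (intro inner_L2_cong_AE m L2_D L) auto
  also have "\<dots> = inner_L2 dX a b"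
    using U(2) a b by (simp add: unitary_on_L2_def)
  finally show "inner_L2 dX (?F a) (?F b) = inner_L2 dX a b" .
qed

text \<open>The kernel is Hermitian because the form is antisymmetric, so the transform coincides with
  its formal adjoint. For the Euclidean transform the adjoint has the conjugate kernel instead.\<close>

lemma symplectic_fourier_symmetric:
  assumes a: "integrable dX a" and b: "integrable dX b"
  shows "inner_L2 dX (symplectic_fourier \<omega> dX a) b = inner_L2 dX a (symplectic_fourier \<omega> dX b)"
proof -
  define e where "e X Y = exp (- (\<i> * of_real (\<omega> X Y)))" for X Y
  have e_measurable: "(\<lambda>(X, Y). e X Y) \<in> borel_measurable (dX \<Otimes>\<^sub>M dX)"
    unfolding e_def by (rule borel_measurable_kernel)
  have [measurable]: "a \<in> borel_measurable dX" "b \<in> borel_measurable dX"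
    using a b by auto
  have cmod_e: "cmod (e X Y) = 1" for X Y
    unfolding e_def by (rule cmod_kernel)
  have cnj_e: "cnj (e X Y) = e Y X" for X Y
    unfolding e_def by (subst symplectic_form_antisym) (simp add: exp_cnj)
  define h where "h X Y = cnj (a Y) * e Y X * b X" for X Y
  have h_measurable: "(\<lambda>(X, Y). h X Y) \<in> borel_measurable (dX \<Otimes>\<^sub>M dX)"
  proof -
    note e_measurable[measurable]
    show ?thesis
      unfolding h_def by measurable
  qed
  have norm_h: "norm (h X Y) = cmod (b X) * cmod (a Y)" for X Y
    by (simp add: h_def norm_mult cmod_e)
  have "integrable (dX \<Otimes>\<^sub>M dX) (\<lambda>(X, Y). h X Y)"
  proof (rule dXdX.Fubini_integrable[OF h_measurable])
    show "integrable dX (\<lambda>X. \<integral>Y. norm (case (X, Y) of (X, Y) \<Rightarrow> h X Y) \<partial>dX)"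
      using a b by (simp add: norm_h)
    show "AE X in dX. integrable dX (\<lambda>Y. case (X, Y) of (X, Y) \<Rightarrow> h X Y)"
    proof (intro AE_I2)
      fix X assume X: "X \<in> space dX"
      have "integrable dX (\<lambda>Y. h X Y)"
      proof (rule Bochner_Integration.integrable_bound)
        show "integrable dX (\<lambda>Y. cmod (b X) * cmod (a Y))"
          using a by simp
        show "(\<lambda>Y. h X Y) \<in> borel_measurable dX"
          using measurable_compose[OF measurable_Pair1'[OF X] h_measurable] by simp
      qed (simp add: norm_h)
      then show "integrable dX (\<lambda>Y. case (X, Y) of (X, Y) \<Rightarrow> h X Y)"
        by simp
    qed
  qed
  note Fubini = dXdX.Fubini_integral[OF this]
  have "inner_L2 dX (symplectic_fourier \<omega> dX a) b = (\<integral>X. (\<integral>Y. cnj (e X Y * a Y) \<partial>dX) * b X \<partial>dX)"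
    by (simp only: pairing_def symplectic_fourier_def e_def Bochner_Integration.integral_cnj)
  also have "\<dots> = (\<integral>X. \<integral>Y. h X Y \<partial>dX \<partial>dX)"
    by (simp only: h_def complex_cnj_mult cnj_e integral_mult_left_zero[symmetric])
       (simp only: mult_ac)
  also have "\<dots> = (\<integral>Y. \<integral>X. h X Y \<partial>dX \<partial>dX)"
    by (rule Fubini[symmetric])
  also have "\<dots> = inner_L2 dX a (symplectic_fourier \<omega> dX b)"
    by (simp only: pairing_def symplectic_fourier_def e_def h_def mult.assoc integral_mult_right_zero)
  finally show ?thesis .
qed

lemma partial_fourier_L2:
  fixes d\<sigma> :: "'s measure"
  assumes F: "F \<in> L2 (product_measure dX d\<sigma>)" "integrable (product_measure dX d\<sigma>) F"
  shows "partial_fourier \<omega> dX F \<in> L2 (product_measure dX d\<sigma>)"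
proof -
  let ?\<nu> = "product_measure dX d\<sigma>"
  have m[measurable]: "F \<in> borel_measurable (dX \<Otimes>\<^sub>M d\<sigma>)"
    using L2_D[OF F(1)] by (simp add: measurable_cong_sets[OF sets_product_measure refl])
  have m'[measurable]: "partial_fourier \<omega> dX F \<in> borel_measurable (dX \<Otimes>\<^sub>M d\<sigma>)"
    by (rule borel_measurable_partial_fourier[OF m])
  have "(\<integral>\<^sup>+z. ennreal ((cmod (partial_fourier \<omega> dX F z))\<^sup>2) \<partial>?\<nu>) =
      (\<integral>\<^sup>+s. \<integral>\<^sup>+X. ennreal ((cmod (partial_fourier \<omega> dX F (X, s)))\<^sup>2) \<partial>dX \<partial>d\<sigma>)"
    by (rule nn_integral_product_measure[OF dX.sigma_finite_measure_axioms]) measurable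
  also have "\<dots> = (\<integral>\<^sup>+s. \<integral>\<^sup>+X. ennreal ((cmod (F (X, s)))\<^sup>2) \<partial>dX \<partial>d\<sigma>)"
  proof (rule nn_integral_cong_AE)
    show "AE s in d\<sigma>. (\<integral>\<^sup>+X. ennreal ((cmod (partial_fourier \<omega> dX F (X, s)))\<^sup>2) \<partial>dX) =
        (\<integral>\<^sup>+X. ennreal ((cmod (F (X, s)))\<^sup>2) \<partial>dX)"
      using AE_L2_fibre[OF dX.sigma_finite_measure_axioms F(1)]
        AE_integrable_fibre[OF dX.sigma_finite_measure_axioms F(2)]
    proof eventually_elim
      case (elim s)
      have "complex_of_real (sqnorm dX (symplectic_fourier \<omega> dX (\<lambda>Y. F (Y, s)))) =
          complex_of_real (sqnorm dX (\<lambda>Y. F (Y, s)))"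
        using symplectic_fourier_L2_inner(2)[OF elim elim] by (simp only: inner_L2_self)
      then show ?case
        using nn_integral_eq_sqnorm[OF symplectic_fourier_L2_inner(1)[OF elim elim]]
          nn_integral_eq_sqnorm[OF elim(1)]
        by (simp add: partial_fourier_def)
    qed
  qed
  also have "\<dots> = (\<integral>\<^sup>+z. ennreal ((cmod (F z))\<^sup>2) \<partial>?\<nu>)"
    by (rule nn_integral_product_measure[OF dX.sigma_finite_measure_axioms, symmetric]) measurable
  also have "\<dots> < \<infinity>"
    using F(1) by (simp add: L2_iff_nn_integral)
  finally show ?thesis
    using m' by (simp add: L2_iff_nn_integral measurable_cong_sets[OF sets_product_measure refl])
qed

text \<open>Almost every fibre of a function in \<open>L\<^sup>1 \<inter> L\<^sup>2\<close> is again of this kind, so that linearity and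
  isometry hold fibrewise.\<close>

lemma partial_fourier_isometry:
  "dense_isometry (product_measure dX d\<sigma>) (partial_fourier \<omega> dX)"
proof
  let ?\<nu> = "product_measure dX d\<sigma>"
  show "partial_fourier \<omega> dX F \<in> L2 ?\<nu>" if "F \<in> L2 ?\<nu>" "integrable ?\<nu> F" for F
    by (rule partial_fourier_L2[OF that])
  fix F G :: "'x \<times> 'a \<Rightarrow> complex"
  assume F: "F \<in> L2 ?\<nu>" "integrable ?\<nu> F" and G: "G \<in> L2 ?\<nu>" "integrable ?\<nu> G"
  note fibres = AE_L2_fibre[OF dX.sigma_finite_measure_axioms F(1)]
    AE_integrable_fibre[OF dX.sigma_finite_measure_axioms F(2)]
    AE_L2_fibre[OF dX.sigma_finite_measure_axioms G(1)]
    AE_integrable_fibre[OF dX.sigma_finite_measure_axioms G(2)]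
  show "inner_L2 ?\<nu> (partial_fourier \<omega> dX F) (partial_fourier \<omega> dX G) = inner_L2 ?\<nu> F G"
  proof (rule inner_L2_product_eqI[OF dX.sigma_finite_measure_axioms partial_fourier_L2[OF F]
        partial_fourier_L2[OF G] F(1) G(1)])
    show "AE s in d\<sigma>. inner_L2 dX (\<lambda>X. partial_fourier \<omega> dX F (X, s)) (\<lambda>X. partial_fourier \<omega> dX G (X, s)) =
        inner_L2 dX (\<lambda>X. F (X, s)) (\<lambda>X. G (X, s))"
      using fibres
    proof eventually_elim
      case (elim s)
      then show ?case
        using symplectic_fourier_L2_inner(2)[OF elim] by (simp add: partial_fourier_def)
    qed
  qed
  fix a b :: complex
  have m: "F \<in> borel_measurable (dX \<Otimes>\<^sub>M d\<sigma>)" "G \<in> borel_measurable (dX \<Otimes>\<^sub>M d\<sigma>)"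
    using L2_D[OF F(1)] L2_D[OF G(1)] by (simp_all add: measurable_cong_sets[OF sets_product_measure refl])
  show "AE z in ?\<nu>. partial_fourier \<omega> dX (\<lambda>y. a * F y + b * G y) z =
      a * partial_fourier \<omega> dX F z + b * partial_fourier \<omega> dX G z"
  proof (rule AE_product_eqI[OF dX.sigma_finite_measure_axioms])
    show "partial_fourier \<omega> dX (\<lambda>y. a * F y + b * G y) \<in> borel_measurable (dX \<Otimes>\<^sub>M d\<sigma>)"
      by (rule borel_measurable_partial_fourier) (use m in measurable)
    show "(\<lambda>z. a * partial_fourier \<omega> dX F z + b * partial_fourier \<omega> dX G z) \<in> borel_measurable (dX \<Otimes>\<^sub>M d\<sigma>)"
      using borel_measurable_partial_fourier[OF m(1)] borel_measurable_partial_fourier[OF m(2)] by measurable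
    show "AE s in d\<sigma>. AE X in dX. partial_fourier \<omega> dX (\<lambda>y. a * F y + b * G y) (X, s) =
        a * partial_fourier \<omega> dX F (X, s) + b * partial_fourier \<omega> dX G (X, s)"
      using fibres
    proof eventually_elim
      case (elim s)
      have *: "integrable dX (\<lambda>Y. exp (- (\<i> * of_real (\<omega> X Y))) * f Y)"
        if f: "integrable dX f" and X: "X \<in> space dX" for f X
      proof (rule Bochner_Integration.integrable_bound[OF f])
        have "(\<lambda>Y. exp (- (\<i> * of_real (\<omega> X Y)))) \<in> borel_measurable dX"
          using measurable_compose[OF measurable_Pair1'[OF X] borel_measurable_kernel] by simp
        with f show "(\<lambda>Y. exp (- (\<i> * of_real (\<omega> X Y))) * f Y) \<in> borel_measurable dX"
          by (intro borel_measurable_times[OF _ borel_measurable_integrable[OF f]])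
      qed (simp add: norm_mult cmod_kernel)
      show ?case
      proof (rule AE_I2)
        fix X assume X: "X \<in> space dX"
        have "(\<integral>Y. exp (- (\<i> * of_real (\<omega> X Y))) * (a * F (Y, s) + b * G (Y, s)) \<partial>dX) =
            (\<integral>Y. a * (exp (- (\<i> * of_real (\<omega> X Y))) * F (Y, s)) +
              b * (exp (- (\<i> * of_real (\<omega> X Y))) * G (Y, s)) \<partial>dX)"
          by (simp only: distrib_left mult.left_commute)
        also have "\<dots> = a * (\<integral>Y. exp (- (\<i> * of_real (\<omega> X Y))) * F (Y, s) \<partial>dX) +
            b * (\<integral>Y. exp (- (\<i> * of_real (\<omega> X Y))) * G (Y, s) \<partial>dX)"
          using *[OF elim(2) X] *[OF elim(4) X] by simp
        finally show "partial_fourier \<omega> dX (\<lambda>y. a * F y + b * G y) (X, s) =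
            a * partial_fourier \<omega> dX F (X, s) + b * partial_fourier \<omega> dX G (X, s)"
          by (simp add: partial_fourier_def symplectic_fourier_def)
      qed
    qed
  qed
qed

lemma partial_fourier_symmetric:
  assumes F: "F \<in> L2 (product_measure dX d\<sigma>)" "integrable (product_measure dX d\<sigma>) F"
    and G: "G \<in> L2 (product_measure dX d\<sigma>)" "integrable (product_measure dX d\<sigma>) G"
  shows "inner_L2 (product_measure dX d\<sigma>) (partial_fourier \<omega> dX F) G =
    inner_L2 (product_measure dX d\<sigma>) F (partial_fourier \<omega> dX G)"
proof (rule inner_L2_product_eqI[OF dX.sigma_finite_measure_axioms partial_fourier_L2[OF F] G(1)
      F(1) partial_fourier_L2[OF G]])
  show "AE s in d\<sigma>. inner_L2 dX (\<lambda>X. partial_fourier \<omega> dX F (X, s)) (\<lambda>X. G (X, s)) =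
      inner_L2 dX (\<lambda>X. F (X, s)) (\<lambda>X. partial_fourier \<omega> dX G (X, s))"
    using AE_integrable_fibre[OF dX.sigma_finite_measure_axioms F(2)]
      AE_integrable_fibre[OF dX.sigma_finite_measure_axioms G(2)]
  proof eventually_elim
    case (elim s)
    then show ?case
      using symplectic_fourier_symmetric[OF elim] by (simp add: partial_fourier_def)
  qed
qed

theorem partial_fourier_L2_unitary:
  "unitary_on_L2 (product_measure dX d\<sigma>) (partial_fourier_L2 \<omega> dX d\<sigma>)"
proof -
  interpret dense_isometry "product_measure dX d\<sigma>" "partial_fourier \<omega> dX"
    by (rule partial_fourier_isometry)
  have "L2_extension (product_measure dX d\<sigma>) (partial_fourier \<omega> dX) (partial_fourier_L2 \<omega> dX d\<sigma>)"
    unfolding partial_fourier_L2_def using ex_L2_extension by (rule someI_ex)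
  then show ?thesis
    by (rule extension_unitary) (rule partial_fourier_symmetric)
qed

end

section \<open>The twist by the action\<close>

text \<open>Without a countable base for \<open>\<Sigma>\<close>, the Borel sets of a product may exceed the product of the
  Borel algebras. One factor with a countable base \<open>B\<close> suffices for equality: an open set \<open>W\<close> is the
  countable union over \<open>b \<in> B\<close> of the rectangles \<open>b \<times> V\<close>, where \<open>V\<close> is the largest open set with
  \<open>b \<times> V \<subseteq> W\<close>.\<close>

lemma measurable_continuous_on_product:
  fixes f :: "'a::second_countable_topology \<times> 'b::topological_space \<Rightarrow> 'c::topological_space"
  assumes f: "continuous_on UNIV f"
  shows "f \<in> measurable (borel \<Otimes>\<^sub>M borel) borel"
proof (rule borel_measurableI)
  fix S :: "'c set" assume "open S"
  with f have W: "open (f -` S)"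
    by (rule open_vimage[rotated])
  obtain B :: "'a set set" where B: "countable B" "topological_basis B"
    using ex_countable_basis by blast
  have "f -` S = (\<Union>b\<in>B. b \<times> \<Union>{V. open V \<and> b \<times> V \<subseteq> f -` S})"
  proof safe
    fix x y assume "f (x, y) \<in> S"
    then have "(x, y) \<in> f -` S"
      by simp
    with W obtain U V where UV: "open U" "open V" "(x, y) \<in> U \<times> V" "U \<times> V \<subseteq> f -` S"
      by (rule open_prod_elim)
    then have "x \<in> U" "y \<in> V"
      by simp_all
    with B(2) UV(1) obtain b where b: "b \<in> B" "x \<in> b" "b \<subseteq> U"
      by (elim topological_basisE)
    have "b \<times> V \<subseteq> f -` S"
      using Sigma_mono[OF b(3), of "\<lambda>_. V" "\<lambda>_. V"] UV(4) by (rule order_trans) simp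
    with UV(2) \<open>y \<in> V\<close> have "y \<in> \<Union>{V. open V \<and> b \<times> V \<subseteq> f -` S}"
      by (intro UnionI[of V]) simp_all
    with b(1,2) show "(x, y) \<in> (\<Union>b\<in>B. b \<times> \<Union>{V. open V \<and> b \<times> V \<subseteq> f -` S})"
      by (intro UN_I[of b]) simp_all
  qed auto
  moreover have "(\<Union>b\<in>B. b \<times> \<Union>{V. open V \<and> b \<times> V \<subseteq> f -` S}) \<in> sets (borel \<Otimes>\<^sub>M borel)"
  proof (rule sets.countable_UN''[OF B(1)])
    fix b assume "b \<in> B"
    then have "open b"
      by (rule topological_basis_open[OF B(2)])
    moreover have "open (\<Union>{V. open V \<and> b \<times> V \<subseteq> f -` S})"
      by (rule open_Union) simp
    ultimately show "b \<times> \<Union>{V. open V \<and> b \<times> V \<subseteq> f -` S} \<in> sets (borel \<Otimes>\<^sub>M borel)"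
      by (intro pair_measureI borel_open)
  qed
  ultimately show "f -` S \<inter> space (borel \<Otimes>\<^sub>M borel) \<in> sets (borel \<Otimes>\<^sub>M borel)"
    by (simp add: space_pair_measure)
qed

text \<open>Inner regularity, extended from sets to functions. It reduces integrals over a base that is
  not sigma-finite to integrals over compact sets.\<close>

lemma nn_integral_le_SUP_compact:
  assumes m: "radon_measure m" and f: "f \<in> borel_measurable m"
  shows "(\<integral>\<^sup>+x. f x \<partial>m) \<le> (SUP K\<in>{K. compact K}. \<integral>\<^sup>+x. f x * indicator K x \<partial>m)"
proof -
  have sets_m: "sets m = sets borel"
    using m by (simp add: radon_measure_def)
  have K: "K \<in> sets m" if "compact K" for K
    using that by (simp add: sets_m borel_closed compact_imp_closed)
  show ?thesis
    using f
  proof (induct rule: borel_measurable_induct)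
    case (cong f g)
    then show ?case
      by (simp cong: nn_integral_cong_simp)
  next
    case (set A)
    have "emeasure m A = (SUP K\<in>{K. compact K \<and> K \<subseteq> A}. emeasure m K)"
      using m set by (simp add: radon_measure_def)
    also have "\<dots> \<le> (SUP K\<in>{K. compact K}. emeasure m (A \<inter> K))"
      by (rule SUP_mono) (auto simp: Int_absorb1)
    also have "\<dots> = (SUP K\<in>{K. compact K}. \<integral>\<^sup>+x. indicator A x * indicator K x \<partial>m)"
      using set K by (intro SUP_cong) (auto simp flip: indicator_inter_arith)
    finally show ?case
      using set by simp
  next
    case (mult u c)
    have "(\<integral>\<^sup>+x. c * u x \<partial>m) \<le> c * (SUP K\<in>{K. compact K}. \<integral>\<^sup>+x. u x * indicator K x \<partial>m)"
      using mult by (simp add: nn_integral_cmult mult_left_mono)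
    also have "\<dots> = (SUP K\<in>{K. compact K}. \<integral>\<^sup>+x. c * u x * indicator K x \<partial>m)"
      unfolding SUP_mult_left_ennreal using mult K
      by (intro SUP_cong refl) (simp add: nn_integral_cmult[symmetric] mult.assoc)
    finally show ?case .
  next
    case (add u v)
    note [measurable] = add(1,4)
    have "(\<integral>\<^sup>+x. v x + u x \<partial>m) = (\<integral>\<^sup>+x. v x \<partial>m) + (\<integral>\<^sup>+x. u x \<partial>m)"
      by (rule nn_integral_add) measurable
    also have "\<dots> \<le> (SUP K\<in>{K. compact K}. \<integral>\<^sup>+x. v x * indicator K x \<partial>m) +
        (SUP K\<in>{K. compact K}. \<integral>\<^sup>+x. u x * indicator K x \<partial>m)"
      by (intro add_mono add)
    also have "\<dots> = (SUP K\<in>{K. compact K}. (\<integral>\<^sup>+x. v x * indicator K x \<partial>m) + (\<integral>\<^sup>+x. u x * indicator K x \<partial>m))"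
    proof (rule SUP_add_directed_ennreal[symmetric])
      fix K L :: "'a set" assume "K \<in> {K. compact K}" "L \<in> {K. compact K}"
      then show "\<exists>N\<in>{K. compact K}. (\<integral>\<^sup>+x. v x * indicator K x \<partial>m) + (\<integral>\<^sup>+x. u x * indicator L x \<partial>m) \<le>
          (\<integral>\<^sup>+x. v x * indicator N x \<partial>m) + (\<integral>\<^sup>+x. u x * indicator N x \<partial>m)"
        by (intro bexI[of _ "K \<union> L"] add_mono nn_integral_mono mult_left_mono)
           (auto simp: indicator_def intro: compact_Un)
    qed
    also have "\<dots> = (SUP K\<in>{K. compact K}. \<integral>\<^sup>+x. (v x + u x) * indicator K x \<partial>m)"
      using K by (intro SUP_cong refl) (simp add: distrib_right nn_integral_add)
    finally show ?case .
  next
    case (seq U)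
    have "(\<integral>\<^sup>+x. (SUP i. U i) x \<partial>m) = (SUP i. \<integral>\<^sup>+x. U i x \<partial>m)"
      using seq by (simp add: nn_integral_monotone_convergence_SUP image_comp)
    also have "\<dots> \<le> (SUP K\<in>{K. compact K}. \<integral>\<^sup>+x. (SUP i. U i) x * indicator K x \<partial>m)"
    proof (rule SUP_least)
      fix i
      note seq(3)[of i]
      also have "(SUP K\<in>{K. compact K}. \<integral>\<^sup>+x. U i x * indicator K x \<partial>m) \<le>
          (SUP K\<in>{K. compact K}. \<integral>\<^sup>+x. (SUP i. U i) x * indicator K x \<partial>m)"
        by (intro SUP_mono' nn_integral_mono mult_right_mono) (auto intro: SUP_upper le_funD)
      finally show "(\<integral>\<^sup>+x. U i x \<partial>m) \<le> (SUP K\<in>{K. compact K}. \<integral>\<^sup>+x. (SUP i. U i) x * indicator K x \<partial>m)" .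
    qed
    finally show ?case .
  qed
qed

lemma continuous_action_uminus:
  fixes \<Theta> :: "'a::real_normed_vector \<Rightarrow> 'b::topological_space \<Rightarrow> 'b"
  assumes \<Theta>: "continuous_action \<Theta>"
  shows "continuous_action (\<lambda>X. \<Theta> (- X))"
proof -
  have "continuous_on UNIV (\<lambda>p :: 'a \<times> 'b. (- fst p, snd p))"
    by (intro continuous_on_Pair continuous_on_minus continuous_on_fst continuous_on_snd continuous_on_id)
  moreover have "continuous_on UNIV (\<lambda>(X, s). \<Theta> X s)"
    using \<Theta> by (simp add: continuous_action_def)
  ultimately have "continuous_on UNIV ((\<lambda>(X, s). \<Theta> X s) \<circ> (\<lambda>p. (- fst p, snd p)))"
    using continuous_on_compose continuous_on_subset subset_UNIV by blast
  moreover have "(\<lambda>(X, s). \<Theta> X s) \<circ> (\<lambda>p. (- fst p, snd p)) = (\<lambda>(X, s). \<Theta> (- X) s)"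
    by auto
  moreover have "\<Theta> (- (X + Y)) s = \<Theta> (- X) (\<Theta> (- Y) s)" for X Y s
    using \<Theta> unfolding continuous_action_def minus_add_distrib by blast
  ultimately show ?thesis
    using \<Theta> unfolding continuous_action_def by simp
qed

definition shear :: "('x \<Rightarrow> 's \<Rightarrow> 's) \<Rightarrow> 'x \<times> 's \<Rightarrow> 'x \<times> 's" where
  "shear \<Theta> = (\<lambda>(X, s). (X, \<Theta> X s))"

context
  fixes dX :: "'x::euclidean_space measure" and d\<sigma> :: "'s::t2_space measure"
  assumes dX: "sigma_finite_measure dX" and sets_dX: "sets dX = sets borel"
    and d\<sigma>: "radon_measure d\<sigma>"
begin

interpretation dX: sigma_finite_measure dX
  by (rule dX)

lemma sets_d\<sigma>: "sets d\<sigma> = sets borel"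
  using d\<sigma>[unfolded radon_measure_def] by (rule conjunct1)

lemma space_d\<sigma>: "space d\<sigma> = UNIV" and space_dX: "space dX = UNIV"
  using sets_eq_imp_space_eq[OF sets_d\<sigma>] sets_eq_imp_space_eq[OF sets_dX]
  by (simp_all only: space_borel)

lemma measurable_action:
  assumes "continuous_action \<Theta>"
  shows "(\<lambda>(X, s). \<Theta> X s) \<in> measurable (dX \<Otimes>\<^sub>M d\<sigma>) d\<sigma>"
proof -
  have "(\<lambda>(X, s). \<Theta> X s) \<in> measurable (borel \<Otimes>\<^sub>M borel) borel"
    using assms by (intro measurable_continuous_on_product) (simp add: continuous_action_def)
  then show ?thesis
    by (simp add: measurable_cong_sets[OF sets_pair_measure_cong[OF sets_dX sets_d\<sigma>] sets_d\<sigma>])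
qed

lemma measurable_shear:
  assumes "continuous_action \<Theta>"
  shows "shear \<Theta> \<in> measurable (dX \<Otimes>\<^sub>M d\<sigma>) (dX \<Otimes>\<^sub>M d\<sigma>)"
proof -
  have "shear \<Theta> = (\<lambda>z. (fst z, (\<lambda>(X, s). \<Theta> X s) z))"
    by (rule ext) (simp add: shear_def split_beta)
  then show ?thesis
    using measurable_Pair[OF measurable_fst measurable_action[OF assms]] by (simp only:)
qed

lemma nn_integral_invariant:
  fixes X :: 'x
  assumes \<Theta>: "continuous_action \<Theta>" and inv: "invariant_measure \<Theta> d\<sigma>"
    and g: "g \<in> borel_measurable d\<sigma>"
  shows "(\<integral>\<^sup>+s. g (\<Theta> X s) \<partial>d\<sigma>) = (\<integral>\<^sup>+s. g s \<partial>d\<sigma>)"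
proof -
  have "X \<in> space dX"
    by (simp add: space_dX)
  then have m: "\<Theta> X \<in> measurable d\<sigma> d\<sigma>"
    using measurable_compose[OF measurable_Pair1'[of X dX d\<sigma>] measurable_action[OF \<Theta>]] by simp
  have "distr d\<sigma> d\<sigma> (\<Theta> X) = d\<sigma>"
    using inv by (intro measure_eqI) (simp_all add: emeasure_distr[OF m] invariant_measure_def space_d\<sigma>)
  then show ?thesis
    using nn_integral_distr[OF m, of g] g by simp
qed

text \<open>Exchanging the two integrals would reduce the claim to the invariance of \<open>d\<sigma>\<close> for each fixed
  \<open>X\<close>, but Tonelli's theorem needs a sigma-finite base. By inner regularity only the part of the left
  side over a compact \<open>K\<close> matters. Its orbit \<open>S\<close> is a countable union of compact sets, since \<open>\<Xi>\<close> is one,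
  so \<open>d\<sigma>\<close> is sigma-finite on \<open>S\<close>; and \<open>S\<close> is invariant, so the restriction of \<open>d\<sigma>\<close> to \<open>S\<close> is again
  an invariant measure. Tonelli's theorem applies there.\<close>

lemma nn_integral_shear_le:
  assumes \<Theta>: "continuous_action \<Theta>" and inv: "invariant_measure \<Theta> d\<sigma>"
    and g: "g \<in> borel_measurable (dX \<Otimes>\<^sub>M d\<sigma>)"
  shows "(\<integral>\<^sup>+s. \<integral>\<^sup>+X. g (X, \<Theta> X s) \<partial>dX \<partial>d\<sigma>) \<le> (\<integral>\<^sup>+s. \<integral>\<^sup>+X. g (X, s) \<partial>dX \<partial>d\<sigma>)"
proof -
  have g\<Theta>: "(\<lambda>(X, s). g (X, \<Theta> X s)) \<in> borel_measurable (dX \<Otimes>\<^sub>M d\<sigma>)"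
  proof -
    have "(\<lambda>(X, s). g (X, \<Theta> X s)) = (\<lambda>z. g (shear \<Theta> z))"
      by (rule ext) (simp add: shear_def split_beta)
    then show ?thesis
      using measurable_compose[OF measurable_shear[OF \<Theta>] g] by (simp only:)
  qed
  define f where "f s = (\<integral>\<^sup>+X. g (X, \<Theta> X s) \<partial>dX)" for s
  have f: "f \<in> borel_measurable d\<sigma>"
    using borel_measurable_nn_integral_fibre[OF dX g\<Theta>] by (simp add: f_def[abs_def])
  have le: "(\<integral>\<^sup>+s. f s * indicator K s \<partial>d\<sigma>) \<le> (\<integral>\<^sup>+s. \<integral>\<^sup>+X. g (X, s) \<partial>dX \<partial>d\<sigma>)" if K: "compact K" for K
  proof -
    define C where "C n = (\<lambda>(X, s). \<Theta> X s) ` (cball 0 (real n) \<times> K)" for n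
    define S where "S = (\<Union>n. C n)"
    have "continuous_on (cball 0 (real n) \<times> K) (\<lambda>(X, s). \<Theta> X s)" for n
      by (rule continuous_on_subset[OF _ subset_UNIV]) (use \<Theta> in \<open>simp add: continuous_action_def\<close>)
    then have "compact (C n)" for n
      unfolding C_def by (rule compact_continuous_image[OF _ compact_Times[OF compact_cball K]])
    then have C: "C n \<in> sets d\<sigma>" "emeasure d\<sigma> (C n) < \<infinity>" for n
      using d\<sigma>[unfolded radon_measure_def, THEN conjunct2, THEN conjunct1]
      by (simp_all only: sets_d\<sigma> borel_closed compact_imp_closed)
    have S[measurable]: "S \<in> sets d\<sigma>"
      unfolding S_def using C(1) by auto
    have S_iff: "s \<in> S \<longleftrightarrow> (\<exists>X. \<exists>k\<in>K. s = \<Theta> X k)" for s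
    proof
      assume "\<exists>X. \<exists>k\<in>K. s = \<Theta> X k"
      then obtain X k where X: "k \<in> K" "s = \<Theta> X k"
        by blast
      obtain n where "norm X \<le> real n"
        using real_arch_simple by blast
      with X have "s \<in> C n"
        unfolding C_def by (intro image_eqI[of _ _ "(X, k)"]) auto
      then show "s \<in> S"
        by (auto simp: S_def)
    qed (auto simp: S_def C_def)
    have K_S: "K \<subseteq> S"
    proof
      fix k assume "k \<in> K"
      moreover have "k = \<Theta> 0 k"
        using \<Theta> by (simp add: continuous_action_def)
      ultimately show "k \<in> S"
        unfolding S_iff by blast
    qed
    have S_action: "\<Theta> X s \<in> S" if s: "s \<in> S" for X s
    proof -
      obtain Y k where "k \<in> K" "s = \<Theta> Y k"
        using s unfolding S_iff by blast
      then have "\<Theta> X s = \<Theta> (X + Y) k"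
        using \<Theta> by (simp add: continuous_action_def)
      with \<open>k \<in> K\<close> show ?thesis
        unfolding S_iff by blast
    qed
    have S_invariant: "\<Theta> X s \<in> S \<longleftrightarrow> s \<in> S" for X s
    proof
      assume "\<Theta> X s \<in> S"
      then have "\<Theta> (- X) (\<Theta> X s) \<in> S"
        by (rule S_action)
      moreover have "\<Theta> (- X) (\<Theta> X s) = \<Theta> (- X + X) s"
        using \<Theta> by (simp only: continuous_action_def)
      ultimately show "s \<in> S"
        using \<Theta> by (simp add: continuous_action_def)
    qed (rule S_action)
    let ?D = "density d\<sigma> (indicator S)"
    interpret D: sigma_finite_measure ?D
    proof
      have "emeasure ?D (C n) \<noteq> \<infinity>" for n
      proof -
        have "emeasure ?D (C n) \<le> emeasure d\<sigma> (C n)"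
          using C(1)[of n] by (simp add: emeasure_density emeasure_mono flip: indicator_inter_arith)
        with C(2)[of n] show ?thesis
          by (auto simp: less_top[symmetric] top_unique)
      qed
      moreover have "emeasure ?D (- S) \<noteq> \<infinity>"
        using sets.compl_sets[OF S] by (simp add: emeasure_density space_d\<sigma> Compl_eq_Diff_UNIV flip: indicator_inter_arith)
      ultimately show "\<exists>A. countable A \<and> A \<subseteq> sets ?D \<and> \<Union>A = space ?D \<and> (\<forall>a\<in>A. emeasure ?D a \<noteq> \<infinity>)"
        using C(1) sets.compl_sets[OF S]
        by (intro exI[of _ "insert (- S) (range C)"])
           (auto simp: S_def space_d\<sigma> Compl_eq_Diff_UNIV)
    qed
    interpret dXD: pair_sigma_finite dX ?D
      by unfold_locales
    have sets_dXD: "sets (dX \<Otimes>\<^sub>M ?D) = sets (dX \<Otimes>\<^sub>M d\<sigma>)"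
      by (intro sets_pair_measure_cong) simp_all
    have Tonelli: "(\<integral>\<^sup>+s. (\<integral>\<^sup>+X. h X s \<partial>dX) * indicator S s \<partial>d\<sigma>) =
        (\<integral>\<^sup>+X. \<integral>\<^sup>+s. h X s * indicator S s \<partial>d\<sigma> \<partial>dX)"
      if h: "(\<lambda>(X, s). h X s) \<in> borel_measurable (dX \<Otimes>\<^sub>M d\<sigma>)" for h
    proof -
      have "(\<integral>\<^sup>+s. (\<integral>\<^sup>+X. h X s \<partial>dX) * indicator S s \<partial>d\<sigma>) = (\<integral>\<^sup>+s. (\<integral>\<^sup>+X. h X s \<partial>dX) \<partial>?D)"
        using borel_measurable_nn_integral_fibre[OF dX h] S
        by (subst nn_integral_density) (simp_all add: mult.commute)
      also have "\<dots> = (\<integral>\<^sup>+X. (\<integral>\<^sup>+s. h X s \<partial>?D) \<partial>dX)"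
        by (rule dXD.Fubini') (simp add: measurable_cong_sets[OF sets_dXD refl] h)
      also have "\<dots> = (\<integral>\<^sup>+X. \<integral>\<^sup>+s. h X s * indicator S s \<partial>d\<sigma> \<partial>dX)"
      proof (rule nn_integral_cong)
        fix X assume "X \<in> space dX"
        then have "(\<lambda>s. h X s) \<in> borel_measurable d\<sigma>"
          using measurable_compose[OF measurable_Pair1'[of X dX d\<sigma>] h] by simp
        then show "(\<integral>\<^sup>+s. h X s \<partial>?D) = (\<integral>\<^sup>+s. h X s * indicator S s \<partial>d\<sigma>)"
          using S by (subst nn_integral_density) (simp_all add: mult.commute)
      qed
      finally show ?thesis .
    qed
    have "(\<integral>\<^sup>+s. f s * indicator K s \<partial>d\<sigma>) \<le> (\<integral>\<^sup>+s. f s * indicator S s \<partial>d\<sigma>)"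
      using K_S by (intro nn_integral_mono mult_left_mono) (auto simp: indicator_def)
    also have "\<dots> = (\<integral>\<^sup>+X. \<integral>\<^sup>+s. g (X, \<Theta> X s) * indicator S s \<partial>d\<sigma> \<partial>dX)"
      unfolding f_def by (rule Tonelli[of "\<lambda>X s. g (X, \<Theta> X s)", OF g\<Theta>])
    also have "\<dots> = (\<integral>\<^sup>+X. \<integral>\<^sup>+s. g (X, \<Theta> X s) * indicator S (\<Theta> X s) \<partial>d\<sigma> \<partial>dX)"
      by (simp only: indicator_def S_invariant)
    also have "\<dots> = (\<integral>\<^sup>+X. \<integral>\<^sup>+s. g (X, s) * indicator S s \<partial>d\<sigma> \<partial>dX)"
    proof (rule nn_integral_cong)
      fix X assume "X \<in> space dX"
      then have "(\<lambda>s. g (X, s)) \<in> borel_measurable d\<sigma>"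
        using measurable_compose[OF measurable_Pair1'[of X dX d\<sigma>] g] by simp
      then have "(\<lambda>s. g (X, s) * indicator S s) \<in> borel_measurable d\<sigma>"
        using S by simp
      then show "(\<integral>\<^sup>+s. g (X, \<Theta> X s) * indicator S (\<Theta> X s) \<partial>d\<sigma>) = (\<integral>\<^sup>+s. g (X, s) * indicator S s \<partial>d\<sigma>)"
        by (rule nn_integral_invariant[OF \<Theta> inv, where g = "\<lambda>s. g (X, s) * indicator S s"])
    qed
    also have "\<dots> = (\<integral>\<^sup>+s. (\<integral>\<^sup>+X. g (X, s) \<partial>dX) * indicator S s \<partial>d\<sigma>)"
      using Tonelli[of "\<lambda>X s. g (X, s)"] g by simp
    also have "\<dots> \<le> (\<integral>\<^sup>+s. \<integral>\<^sup>+X. g (X, s) \<partial>dX \<partial>d\<sigma>)"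
      by (intro nn_integral_mono) (auto simp: indicator_def)
    finally show ?thesis .
  qed
  have "(SUP K\<in>{K. compact K}. \<integral>\<^sup>+s. f s * indicator K s \<partial>d\<sigma>) \<le> (\<integral>\<^sup>+s. \<integral>\<^sup>+X. g (X, s) \<partial>dX \<partial>d\<sigma>)"
  proof (rule SUP_least)
    fix K :: "'s set" assume "K \<in> {K. compact K}"
    then show "(\<integral>\<^sup>+s. f s * indicator K s \<partial>d\<sigma>) \<le> (\<integral>\<^sup>+s. \<integral>\<^sup>+X. g (X, s) \<partial>dX \<partial>d\<sigma>)"
      by (intro le) (rule CollectD)
  qed
  then have "(\<integral>\<^sup>+s. f s \<partial>d\<sigma>) \<le> (\<integral>\<^sup>+s. \<integral>\<^sup>+X. g (X, s) \<partial>dX \<partial>d\<sigma>)"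
    by (rule order_trans[OF nn_integral_le_SUP_compact[OF d\<sigma> f]])
  then show ?thesis
    unfolding f_def[abs_def] .
qed

lemma shear_uminus:
  assumes \<Theta>: "continuous_action \<Theta>"
  shows "shear \<Theta> (shear (\<lambda>X. \<Theta> (- X)) z) = z" and "shear (\<lambda>X. \<Theta> (- X)) (shear \<Theta> z) = z"
proof -
  have 0: "\<Theta> 0 s = s" and add: "\<Theta> X (\<Theta> Y s) = \<Theta> (X + Y) s" for X Y s
    using \<Theta> by (simp_all add: continuous_action_def)
  show "shear \<Theta> (shear (\<lambda>X. \<Theta> (- X)) z) = z" "shear (\<lambda>X. \<Theta> (- X)) (shear \<Theta> z) = z"
    by (simp_all add: shear_def split_beta add 0)
qed

text \<open>The opposite inequality is the same one for the inverse action.\<close>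

lemma nn_integral_shear:
  assumes \<Theta>: "continuous_action \<Theta>" and inv: "invariant_measure \<Theta> d\<sigma>"
    and g: "g \<in> borel_measurable (dX \<Otimes>\<^sub>M d\<sigma>)"
  shows "(\<integral>\<^sup>+z. g (shear \<Theta> z) \<partial>product_measure dX d\<sigma>) = (\<integral>\<^sup>+z. g z \<partial>product_measure dX d\<sigma>)"
proof -
  have le: "(\<integral>\<^sup>+z. h (shear \<Phi> z) \<partial>product_measure dX d\<sigma>) \<le> (\<integral>\<^sup>+z. h z \<partial>product_measure dX d\<sigma>)"
    if \<Phi>: "continuous_action \<Phi>" "invariant_measure \<Phi> d\<sigma>" and h: "h \<in> borel_measurable (dX \<Otimes>\<^sub>M d\<sigma>)"
    for \<Phi> h
    using nn_integral_shear_le[OF \<Phi> h] nn_integral_product_measure[OF dX h]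
      nn_integral_product_measure[OF dX measurable_compose[OF measurable_shear[OF \<Phi>(1)] h]]
    by (simp add: shear_def)
  let ?\<Theta>' = "\<lambda>X. \<Theta> (- X)"
  have "invariant_measure ?\<Theta>' d\<sigma>"
    using inv by (simp add: invariant_measure_def)
  from le[OF continuous_action_uminus[OF \<Theta>] this measurable_compose[OF measurable_shear[OF \<Theta>] g]]
  have "(\<integral>\<^sup>+z. g z \<partial>product_measure dX d\<sigma>) \<le> (\<integral>\<^sup>+z. g (shear \<Theta> z) \<partial>product_measure dX d\<sigma>)"
    by (simp only: shear_uminus(1)[OF \<Theta>])
  with le[OF \<Theta> inv g] show ?thesis
    by (rule antisym)
qed

lemma distr_shear:
  assumes \<Theta>: "continuous_action \<Theta>" and inv: "invariant_measure \<Theta> d\<sigma>"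
  shows "distr (product_measure dX d\<sigma>) (product_measure dX d\<sigma>) (shear \<Theta>) = product_measure dX d\<sigma>"
proof (rule measure_eqI)
  let ?\<nu> = "product_measure dX d\<sigma>"
  fix A assume "A \<in> sets (distr ?\<nu> ?\<nu> (shear \<Theta>))"
  then have A: "A \<in> sets ?\<nu>" "A \<in> sets (dX \<Otimes>\<^sub>M d\<sigma>)"
    by (simp_all add: sets_product_measure)
  have m: "shear \<Theta> \<in> measurable ?\<nu> ?\<nu>"
    using measurable_shear[OF \<Theta>] by (simp only: measurable_cong_sets[OF sets_product_measure sets_product_measure])
  have "emeasure (distr ?\<nu> ?\<nu> (shear \<Theta>)) A = (\<integral>\<^sup>+z. indicator A z \<partial>distr ?\<nu> ?\<nu> (shear \<Theta>))"
    using A(1) by simp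
  also have "\<dots> = (\<integral>\<^sup>+z. indicator A (shear \<Theta> z) \<partial>?\<nu>)"
    using A(1) by (intro nn_integral_distr[OF m]) simp
  also have "\<dots> = (\<integral>\<^sup>+z. indicator A z \<partial>?\<nu>)"
    using A(2) by (intro nn_integral_shear[OF \<Theta> inv]) simp
  also have "\<dots> = emeasure ?\<nu> A"
    using A(1) by simp
  finally show "emeasure (distr ?\<nu> ?\<nu> (shear \<Theta>)) A = emeasure ?\<nu> A" .
qed simp

theorem twist_unitary:
  assumes \<Theta>: "continuous_action \<Theta>" and inv: "invariant_measure \<Theta> d\<sigma>"
  shows "unitary_on_L2 (product_measure dX d\<sigma>) (twist \<Theta>)"
proof -
  let ?\<nu> = "product_measure dX d\<sigma>" and ?\<Theta>' = "\<lambda>X. \<Theta> (- X)"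
  have m: "shear \<Phi> \<in> measurable ?\<nu> ?\<nu>" if "continuous_action \<Phi>" for \<Phi>
    using measurable_shear[OF that] by (simp only: measurable_cong_sets[OF sets_product_measure sets_product_measure])
  have inv': "invariant_measure ?\<Theta>' d\<sigma>"
    using inv by (simp add: invariant_measure_def)
  have twist: "twist \<Theta> = (\<lambda>F z. F (shear \<Theta> z))"
    by (intro ext) (simp add: twist_def shear_def split_beta)
  show ?thesis
    unfolding twist
    by (rule unitary_on_L2_measure_preserving[OF m[OF \<Theta>] distr_shear[OF \<Theta> inv]
        m[OF continuous_action_uminus[OF \<Theta>]] distr_shear[OF continuous_action_uminus[OF \<Theta>] inv']
        shear_uminus(2)[OF \<Theta>]])
qed

end

section \<open>Unitarity of the canonical mapping\<close>

theorem proposition6p7: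
  fixes \<omega> :: "'x::euclidean_space \<Rightarrow> 'x \<Rightarrow> real"
    and n :: nat
    and dX :: "'x measure"
    and \<Theta> :: "'x \<Rightarrow> 's::t2_space \<Rightarrow> 's"
    and d\<sigma> :: "'s measure"
  assumes "DIM('x) = 2 * n"
    and "symplectic_form \<omega>"
    and "normalized_lebesgue \<omega> dX"
    and "locally_compact_space (euclidean :: 's topology)"
    and "continuous_action \<Theta>"
    and "radon_measure d\<sigma>"
    and "invariant_measure \<Theta> d\<sigma>"
  defines "\<nu> \<equiv> product_measure dX d\<sigma>"
    and "M \<equiv> canonical_map \<omega> dX d\<sigma> \<Theta>"
  shows "(\<forall>F\<in>L2 \<nu>. \<forall>G\<in>L2 \<nu>.
            pairing \<nu> (\<lambda>z. cnj (M F z)) (M G) = pairing \<nu> (\<lambda>z. cnj (F z)) G) \<and>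
         unitary_on_L2 \<nu> M"
proof -
  have "unitary_on_L2 \<nu> M"
    unfolding M_def \<nu>_def canonical_map_def
    by (rule unitary_on_L2_compose[OF partial_fourier_L2_unitary[OF assms(2,3)]
        twist_unitary[OF sigma_finite_normalized_lebesgue[OF assms(3)]
          sets_normalized_lebesgue[OF assms(3)] assms(6) assms(5) assms(7)]])
  then show ?thesis
    by (simp add: unitary_on_L2_def)
qed

end
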